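(* Let $d,l\ge 1$ and $n\ge 2$ be integers. Then the following hold: \begin{itemize} \item $H_0(n,d)=2$ if $d=1$ and $n\ge 2$; \item $H_0(n,d)=5$ if $d=2$ and $n\ge 5$; \item $H_0(n,d)\le 7$ if $d=3$ and $n\ge 7$; \item $H_0(n,d)=n$ if $d\ge 2$ and $n\le 2d+1$; \item $H_0(n,d)\le n-1$ if $d\ge 4$ and $n\ge 2d+\lceil\frac{d+1}{2}\rceil$; \item $H_0(n,d)\le n-2$ if $d\ge 4$ and $n\ge 2d+\lceil\frac{d+1}{2}\rceil+1$; \item $H_0(n,d)\le n-(l+2)$ if $d\ge 4$ and $2d+3+l(d-2)\le n<2d+3+(l+1)(d-2)$. \end{itemize}
   Context: A set $X\subset\mathbb{R}^d$ is in general position if every subset of at most $d+1$ of its points is affinely independent. A projective transformation $T$ of $\mathbb{R}^d$ is a map of the form $T(x)=\frac{Ax+b}{\langle c,x\rangle+\delta}$, where $A$ is a linear transformation of $\mathbb{R}^d$, $b,c\in\mathbb{R}^d$, $\delta\in\mathbb{R}$, and at least one of $c\ne 0$, $\delta\ne 0$ holds. It is permissible for $X\subset\mathbb{R}^d$ if $\langle c,x\rangle+\delta\neq 0$ for all $x\in X$. For a polytope $P$, $f_k(P)$ denotes the number of $k$-dimensional faces of $P$ (so $f_0(P)$ is the number of vertices). For integers $d\ge k\ge 0$ and a finite set $X\subset\mathbb{R}^d$ of points in general position, $h_k(X,d)=\max_T f_k(\mathrm{conv}(T(X)))$, the maximum being over all projective transformations $T$ permissible for $X$, and $H_k(n,d)=\min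 h_k(X,d)$, the minimum being over all sets $X\subset\mathbb{R}^d$ of $n$ points in general position. *)

theory Defs
  imports "HOL-Analysis.Analysis"
begin

definition general_position :: "'a::euclidean_space set \<Rightarrow> bool" where
  "general_position X \<longleftrightarrow>
     (\<forall>S. S \<subseteq> X \<and> finite S \<and> card S \<le> DIM('a) + 1 \<longrightarrow> \<not> affine_dependent S)"

definition face_number :: "nat \<Rightarrow> 'a::euclidean_space set \<Rightarrow> nat" where
  "face_number k P = card {F. F face_of P \<and> aff_dim F = int k}"

definition projective_map ::
    "('a::euclidean_space \<Rightarrow> 'a) \<Rightarrow> 'a \<Rightarrow> 'a \<Rightarrow> real \<Rightarrow> 'a \<Rightarrow> 'a" where
  "projective_map A b c \<delta> x = (A x + b) /\<^sub>R (c \<bullet> x + \<delta>)"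

text \<open>
  \<open>A\<close> is an arbitrary linear transformation: invertibility is not required. The denominator is
  part of the data of a projective transformation, since permissibility depends on it and not only
  on the resulting function.
\<close>

definition permissible_parameters ::
    "'a::euclidean_space set \<Rightarrow> (('a \<Rightarrow> 'a) \<times> 'a \<times> 'a \<times> real) set" where
  "permissible_parameters X =
     {(A, b, c, \<delta>). linear A \<and> (c \<noteq> 0 \<or> \<delta> \<noteq> 0) \<and> (\<forall>x\<in>X. c \<bullet> x + \<delta> \<noteq> 0)}"

definition proj_h :: "nat \<Rightarrow> 'a::euclidean_space set \<Rightarrow> nat" where
  "proj_h k X =
     Max ((\<lambda>(A, b, c, \<delta>). face_number k (convex hull (projective_map A b c \<delta> ` X)))
            ` permissible_parameters X)"

definition proj_H :: "nat \<Rightarrow> nat \<Rightarrow> 'a::euclidean_space itself \<Rightarrow> nat" where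
  "proj_H k n t =
     Min (proj_h k ` {X :: 'a set. finite X \<and> card X = n \<and> general_position X})"

text \<open>
  The sets under \<^const>\<open>Max\<close> and \<^const>\<open>Min\<close> above are finite.
\<close>

lemma face_number_convex_hull_le:
  fixes S :: "'a::euclidean_space set"
  assumes "finite S"
  shows "face_number k (convex hull S) \<le> 2 ^ card S"
proof -
  have "{F. F face_of convex hull S \<and> aff_dim F = int k} \<subseteq> (\<lambda>T. convex hull T) ` Pow S"
    using face_of_convex_hull_subset[OF finite_imp_compact[OF assms]] by blast
  then have "face_number k (convex hull S) \<le> card ((\<lambda>T. convex hull T) ` Pow S)"
    unfolding face_number_def using assms by (intro card_mono) auto
  also have "\<dots> \<le> card (Pow S)"
    using assms by (intro card_image_le) simp
  finally show ?thesis
    using assms by (simp add: card_Pow)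
qed

lemma face_number_projective_image_le:
  assumes "finite X"
  shows "face_number k (convex hull (projective_map A b c \<delta> ` X)) \<le> 2 ^ card X"
proof -
  have "face_number k (convex hull (projective_map A b c \<delta> ` X))
          \<le> 2 ^ card (projective_map A b c \<delta> ` X)"
    using assms by (intro face_number_convex_hull_le) simp
  also have "\<dots> \<le> 2 ^ card X"
    using assms by (intro power_increasing card_image_le) auto
  finally show ?thesis .
qed

lemma proj_h_range:
  fixes X :: "'a::euclidean_space set" and k :: nat
  assumes "finite X"
  defines "V \<equiv> (\<lambda>(A, b, c, \<delta>). face_number k (convex hull (projective_map A b c \<delta> ` X)))
                  ` permissible_parameters X"
  shows "finite V" and "V \<noteq> {}" and "proj_h k X \<le> 2 ^ card X"
proof -
  have sub: "V \<subseteq> {..2 ^ card X}"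
    unfolding V_def using face_number_projective_image_le[OF assms(1)] by auto
  then show fin: "finite V"
    by (rule finite_subset) simp
  have "((\<lambda>x. x), 0, 0, 1) \<in> permissible_parameters X"
    by (simp add: permissible_parameters_def linear_id[unfolded id_def])
  then show ne: "V \<noteq> {}"
    unfolding V_def by blast
  have "Max V \<in> V"
    using fin ne by (rule Max_in)
  then show "proj_h k X \<le> 2 ^ card X"
    using sub by (auto simp: proj_h_def V_def)
qed

lemma finite_proj_H_range:
  "finite (proj_h k ` {X :: 'a::euclidean_space set.
                         finite X \<and> card X = n \<and> general_position X})"
  by (rule finite_subset[of _ "{..2 ^ n}"]) (use proj_h_range(3) in auto)

end

theory Submission
  imports Defs
begin

text \<open>
  Lift a point \<open>x\<close> of \<open>\<real>\<^sup>d\<close> to the vector \<open>(x, 1)\<close> of \<open>\<real>\<^sup>d\<^sup>+\<^sup>1\<close> and read it as the normal of a central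
  hyperplane. The denominator \<open>\<phi>\<close> of a permissible transformation of \<open>X\<close> is a point off all these
  hyperplanes, hence lies in one open cell of the arrangement. The image of \<open>X\<close> is a linear image of the
  points \<open>(x, 1) / \<phi>(x)\<close>, and such a point is a vertex of their hull exactly if the hyperplane of \<open>x\<close> is a
  wall of the cell. So \<open>h\<^sub>0(X)\<close> is the largest number of walls of a cell, and both kinds of bounds become
  statements about arrangements.

  \<^emph>\<open>Lower bounds.\<close> Every simple arrangement of more than \<open>d + 1\<close> hyperplanes has a simplicial cell \<open>\<Delta>\<close> (\<open>simplicial_cell\<close>): take a hyperplane
  and the vertex of the arrangement closest to it. If there are \<open>2d + 1\<close> hyperplanes, the \<open>d\<close> of them that do
  not bound \<open>\<Delta>\<close> meet in one point \<open>x\<close>. Some cell reaches from a place next to \<open>\<Delta>\<close> to \<open>x\<close>; it has the \<open>d\<close>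
  hyperplanes through \<open>x\<close> as walls because they meet at \<open>x\<close>, and the \<open>d + 1\<close> bounding hyperplanes of \<open>\<Delta>\<close> as
  walls because near \<open>\<Delta>\<close> all cells of the arrangement of these hyperplanes except one are present
  (\<open>complete_cell\<close>). This settles \<open>n \<le> 2d + 1\<close>. In the plane, a cell with at least five walls remains
  available when a line is added: if the line meets the cell, it cuts it in two parts whose numbers of walls add up to
  at least \<open>5 + 4\<close> (\<open>five_walls\<close>).

  \<^emph>\<open>Upper bounds.\<close> They all come from one family of configurations, for which every cell with \<open>n\<close>
  hyperplanes has at most \<open>n - L\<close> walls (\<open>ex_few_vertices\<close>). Prescribe a sign matrix with rows
  \<open>1, \<dots>, r = d + 1\<close> and a column for each point, and choose the coordinates of the points with these signs but
  growing very fast from row to row and from column to column (\<open>ex_realizes\<close>). Then the minimal positive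
  dependencies of the signed vectors can be read off from the signs: they are the chains of \<open>r + 1\<close> columns
  \<open>i\<^sub>0 < \<dots> < i\<^sub>r\<close> for which row \<open>k\<close> changes sign from \<open>i\<^bsub>k-1\<^esub>\<close> to \<open>i\<^sub>k\<close>. A choice of signs \<open>\<sigma>\<close>
  is a cell only if the matrix signed by \<open>\<sigma>\<close> has no such chain, and a column is not a wall if flipping its sign
  creates one.

  Two greedy staircases describe the chains of a cell: \<open>T\<close> starts in row \<open>1\<close> of the first column, runs to the right
  and goes to the next row whenever its row changes sign; \<open>B\<close> starts in row \<open>r\<close> of the last column and runs to the left in
  the same way. A column \<open>x\<close> can be a wall only if \<open>T\<close> has just moved to another row or if \<open>B(x + 1)\<close> exceeds \<open>T(x)\<close>. The matrix is
  chosen so that between the columns \<open>x\<close> and \<open>x + 1\<close> precisely the rows \<open>k > 2 J(x)\<close> change sign. As long as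
  \<open>T \<le> 2 J < B\<close>, one of the staircases must then move in each column, and they have only \<open>2d\<close> moves in all. A potential
  built from \<open>T\<close> and \<open>B\<close> grows by at least one with every wall (\<open>level_step\<close>), which bounds the number of walls by
  \<open>2d + \<lfloor>d/2\<rfloor>\<close>, except for columns where both staircases stall on the same side of the threshold. The
  threshold rises by two after every block of at least five columns. A stall with \<open>T > 2 J\<close> means that the
  staircases are ahead of the threshold, so that few rows are left for the remaining columns; a stall with \<open>B \<le> 2 J\<close> means that they
  are behind, so that few rows were used up by the columns so far. Either way, and also between a stall ahead and a later one
  behind, there are at least \<open>L\<close> columns that are not walls (\<open>card_facets\<close>).
\<close>

section \<open>Chains in sign matrices and the two greedy staircases\<close>

text \<open>
  \<open>chain b k C e\<close>: the columns \<open>C = {i\<^sub>0 < \<dots> < i\<^bsub>k-1\<^esub> = e}\<close> are such that row \<open>j\<close> of \<open>b\<close> separates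
  \<open>i\<^bsub>j-1\<^esub>\<close> from \<open>i\<^sub>j\<close> for \<open>0 < j < k\<close>. Row \<open>k\<close> is the one that a continuation beyond \<open>e\<close> has to use.
\<close>
inductive chain :: "(nat \<Rightarrow> nat \<Rightarrow> bool) \<Rightarrow> nat \<Rightarrow> nat set \<Rightarrow> nat \<Rightarrow> bool" for b where
  start: "chain b 1 {e} e"
| step: "chain b k C e \<Longrightarrow> e < f \<Longrightarrow> b k e \<noteq> b k f \<Longrightarrow> chain b (Suc k) (insert f C) f"

lemma chain_props:
  assumes "chain b k C e"
  shows "finite C \<and> card C = k \<and> e \<in> C \<and> (\<forall>i\<in>C. i \<le> e) \<and> k \<ge> 1"
  using assms
proof (induction rule: chain.induct)
  case (step k C e f)
  then have "f \<notin> C" by force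
  with step show ?case by force
qed auto

lemma chain_cong:
  assumes "chain b k C e" and "\<And>k i. i \<le> e \<Longrightarrow> b' k i = b k i"
  shows "chain b' k C e"
  using assms
proof (induction rule: chain.induct)
  case (start e)
  show ?case by (rule chain.start)
next
  case (step k C e f)
  then show ?case by (intro chain.step) auto
qed

text \<open>
  The staircase from the left is the greedy chain: it waits in a row until that row changes sign and then
  goes down one row, so it reaches every row as early as any chain can.
\<close>
fun top_row :: "(nat \<Rightarrow> nat \<Rightarrow> bool) \<Rightarrow> nat \<Rightarrow> nat" where
  "top_row b 0 = 1"
| "top_row b (Suc x) =
     (if b (top_row b x) x = b (top_row b x) (Suc x) then top_row b x else Suc (top_row b x))"

lemma chain_top_row:
  "\<exists>C e. e \<le> x \<and> chain b (top_row b x) C e \<and> b (top_row b x) e = b (top_row b x) x"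
proof (induction x)
  case 0
  show ?case using chain.start[of b 0] by (intro exI[of _ "{0}"] exI[of _ 0]) simp
next
  case (Suc x)
  then obtain C e where C: "e \<le> x" "chain b (top_row b x) C e"
    "b (top_row b x) e = b (top_row b x) x" by blast
  show ?case
  proof (cases "b (top_row b x) x = b (top_row b x) (Suc x)")
    case True
    then show ?thesis using C by (intro exI[of _ C] exI[of _ e]) simp
  next
    case False
    with C have "chain b (Suc (top_row b x)) (insert (Suc x) C) (Suc x)"
      by (intro chain.step[of _ _ _ e]) auto
    with False show ?thesis by auto
  qed
qed

text \<open>
  The staircase from the right starts in row \<open>r\<close> at the last column \<open>N\<close>; the recursion runs over the distance
  to \<open>N\<close>. It shows how late a chain may be in a row and still be completed.
\<close>
fun bottom_row :: "(nat \<Rightarrow> nat \<Rightarrow> bool) \<Rightarrow> nat \<Rightarrow> nat \<Rightarrow> nat \<Rightarrow> nat" where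
  "bottom_row b r N 0 = r"
| "bottom_row b r N (Suc m) = (let w = bottom_row b r N m in
     if b w (N - Suc m) = b w (N - m) then w else w - 1)"

definition bot_row :: "(nat \<Rightarrow> nat \<Rightarrow> bool) \<Rightarrow> nat \<Rightarrow> nat \<Rightarrow> nat \<Rightarrow> nat" where
  "bot_row b r N x = bottom_row b r N (N - x)"

lemma bot_row_last [simp]: "bot_row b r N N = r"
  by (simp add: bot_row_def)

lemma bot_row_step:
  assumes "x < N"
  shows "bot_row b r N x = (if b (bot_row b r N (Suc x)) x = b (bot_row b r N (Suc x)) (Suc x)
           then bot_row b r N (Suc x) else bot_row b r N (Suc x) - 1)"
proof -
  have "N - x = Suc (N - Suc x)" "N - Suc (N - Suc x) = x" "N - (N - Suc x) = Suc x"
    using assms by auto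
  then show ?thesis by (simp add: bot_row_def Let_def)
qed

text \<open>
  A chain that has reached row \<open>k\<close> can be completed if it lies strictly below the staircase \<open>B\<close> from the
  right. Walk to the right: if row \<open>k\<close> changes sign, the chain goes down one row, and \<open>B\<close> falls by at most one;
  if it does not, \<open>B\<close> cannot step into row \<open>k\<close>. The recursion for \<open>B\<close> is assumed from \<open>y\<close> on
  only, so that \<open>B\<close> may be the staircase of the matrix before the sign of a column to the left of \<open>y\<close> was flipped.
\<close>
lemma chain_completes:
  assumes "B N = r"
    and "\<And>z. y \<le> z \<Longrightarrow> z < N \<Longrightarrow>
           B z = (if b (B (Suc z)) z = b (B (Suc z)) (Suc z) then B (Suc z) else B (Suc z) - 1)"
    and "B y < k" "k \<le> Suc r" "y \<le> N" "chain b k C e" "e \<le> y" "b k e = b k y"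
  shows "\<exists>C' e'. chain b (Suc r) C' e' \<and> e' \<le> N"
  using assms(2-)
proof (induction "N - y" arbitrary: y k C e)
  case 0
  then have "y = N" by simp
  with 0 assms(1) have "k = Suc r" by simp
  with 0 \<open>y = N\<close> show ?case by blast
next
  case (Suc m)
  show ?case
  proof (cases "k = Suc r")
    case True
    with Suc.prems show ?thesis by (meson le_trans)
  next
    case False
    have yN: "y < N" using Suc.hyps(2) by simp
    have rec: "B y = (if b (B (Suc y)) y = b (B (Suc y)) (Suc y) then B (Suc y) else B (Suc y) - 1)"
      using Suc.prems(1)[of y] yN by simp
    have m: "m = N - Suc y" using Suc.hyps(2) by simp
    have IH: "\<And>k C e. B (Suc y) < k \<Longrightarrow> k \<le> Suc r \<Longrightarrow> chain b k C e \<Longrightarrow> e \<le> Suc y \<Longrightarrow>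
        b k e = b k (Suc y) \<Longrightarrow> \<exists>C' e'. chain b (Suc r) C' e' \<and> e' \<le> N"
      using Suc.hyps(1)[OF m] Suc.prems(1) yN by (metis Suc_leD Suc_leI)
    show ?thesis
    proof (cases "b k y = b k (Suc y)")
      case True
      have "B (Suc y) < k"
      proof (rule ccontr)
        assume "\<not> B (Suc y) < k"
        with rec Suc.prems(2) True show False by (cases "B (Suc y) = k") (auto split: if_splits)
      qed
      then show ?thesis using IH[of k C e] Suc.prems True by auto
    next
      case F: False
      have "chain b (Suc k) (insert (Suc y) C) (Suc y)"
        using Suc.prems F by (intro chain.step[of _ _ _ e]) auto
      moreover have "B (Suc y) < Suc k" using rec Suc.prems(2) by (auto split: if_splits)
      ultimately show ?thesis using IH[of "Suc k"] False Suc.prems(3) by auto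
    qed
  qed
qed

definition flip :: "nat \<Rightarrow> (nat \<Rightarrow> nat \<Rightarrow> bool) \<Rightarrow> nat \<Rightarrow> nat \<Rightarrow> bool" where
  "flip x b k i = (if i = x then \<not> b k i else b k i)"

definition no_full_chain :: "nat \<Rightarrow> nat \<Rightarrow> (nat \<Rightarrow> nat \<Rightarrow> bool) \<Rightarrow> bool" where
  "no_full_chain r N b \<longleftrightarrow> (\<forall>C e. chain b (Suc r) C e \<longrightarrow> N < e)"

lemma top_row_le:
  assumes "no_full_chain r N b" "r \<ge> 1" "x \<le> N"
  shows "top_row b x \<le> r"
  using assms(3)
proof (induction x)
  case (Suc x)
  show ?case
  proof (rule ccontr)
    assume "\<not> ?thesis"
    with Suc have "top_row b (Suc x) = Suc r" by (auto split: if_splits)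
    then obtain C e where "e \<le> Suc x" "chain b (Suc r) C e" using chain_top_row[of "Suc x" b] by metis
    with assms(1) Suc.prems show False unfolding no_full_chain_def by fastforce
  qed
qed (use assms in simp)

lemma top_row_le_bot_row:
  assumes "no_full_chain r N b" "r \<ge> 1" "x \<le> N"
  shows "top_row b x \<le> bot_row b r N x"
proof (rule ccontr)
  assume a: "\<not> ?thesis"
  obtain C e where C: "e \<le> x" "chain b (top_row b x) C e" "b (top_row b x) e = b (top_row b x) x"
    using chain_top_row by blast
  have "\<exists>C' e'. chain b (Suc r) C' e' \<and> e' \<le> N"
    using a top_row_le[OF assms] assms(3)
    by (intro chain_completes[where y = x and B = "bot_row b r N", OF _ _ _ _ _ C(2,1,3)]
          bot_row_step) auto
  with assms(1) show False unfolding no_full_chain_def by fastforce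
qed

lemma flip_completes:
  assumes "x < N" "bot_row b r N (Suc x) < k" "k \<le> Suc r" "chain (flip x b) k C e" "e \<le> Suc x"
    and "flip x b k e = flip x b k (Suc x)"
  shows "\<not> no_full_chain r N (flip x b)"
proof -
  have "\<exists>C' e'. chain (flip x b) (Suc r) C' e' \<and> e' \<le> N"
    using assms(1-3)
    by (intro chain_completes[where y = "Suc x" and B = "bot_row b r N", OF _ _ _ _ _ assms(4-6)])
       (simp_all add: flip_def bot_row_step)
  then show ?thesis unfolding no_full_chain_def by fastforce
qed

text \<open>
  Columns that are not walls. The flipped column extends the greedy chain, since \<open>T\<close> did not step there, and
  puts it into row \<open>T + 1\<close> with the opposite sign. If that row originally keeps its sign towards the next
  column, the flip makes it change, and the chain gains a second row at once; otherwise the chain waits in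
  row \<open>T + 1\<close>. In both cases the hypothesis on \<open>B\<close> is what \<open>chain_completes\<close> asks for.
\<close>
lemma full_chain_flip_inner:
  assumes "no_full_chain r N b" "r \<ge> 1" "Suc x < N" and same: "top_row b (Suc x) = top_row b x"
    and low: "bot_row b r N (Suc (Suc x)) \<le> top_row b x +
         (if b (Suc (top_row b x)) (Suc x) = b (Suc (top_row b x)) (Suc (Suc x)) then 1 else 0)"
  shows "\<not> no_full_chain r N (flip (Suc x) b)"
proof -
  let ?k = "top_row b x" and ?b = "flip (Suc x) b"
  obtain C e where C: "e \<le> x" "chain b ?k C e" "b ?k e = b ?k x" using chain_top_row by blast
  have "b ?k x = b ?k (Suc x)" using same by (auto split: if_splits)
  with C have "?b ?k e \<noteq> ?b ?k (Suc x)" by (auto simp: flip_def)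
  moreover have "chain ?b ?k C e" by (rule chain_cong[OF C(2)]) (use C(1) in \<open>auto simp: flip_def\<close>)
  ultimately have ch: "chain ?b (Suc ?k) (insert (Suc x) C) (Suc x)"
    using C(1) by (intro chain.step[of _ _ _ e]) auto
  have kr: "?k \<le> r" using top_row_le[OF assms(1,2), of x] assms(3) by simp
  show ?thesis
  proof (cases "b (Suc ?k) (Suc x) = b (Suc ?k) (Suc (Suc x)) \<and> ?k < r")
    case True
    then have "?b (Suc ?k) (Suc x) \<noteq> ?b (Suc ?k) (Suc (Suc x))" by (auto simp: flip_def)
    then have "chain ?b (Suc (Suc ?k)) (insert (Suc (Suc x)) (insert (Suc x) C)) (Suc (Suc x))"
      using chain.step[OF ch, of "Suc (Suc x)"] by simp
    then show ?thesis using low True kr assms(3)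
      by (intro flip_completes[of "Suc x" N b r "Suc (Suc ?k)"]) auto
  next
    case False
    show ?thesis
    proof (cases "?k < r")
      case True
      with False show ?thesis using low ch kr assms(3)
        by (intro flip_completes[of "Suc x" N b r "Suc ?k"]) (auto simp: flip_def)
    next
      case False
      with kr ch have "chain ?b (Suc r) (insert (Suc x) C) (Suc x)" by simp
      then show ?thesis using assms(3) unfolding no_full_chain_def by fastforce
    qed
  qed
qed

lemma full_chain_flip_first:
  assumes "0 < N" "r \<ge> 1" "bot_row b r N 1 = 1" "b 1 0 = b 1 1"
  shows "\<not> no_full_chain r N (flip 0 b)"
proof -
  have "chain (flip 0 b) (Suc 1) (insert 1 {0}) 1"
    using assms by (intro chain.step[OF chain.start]) (auto simp: flip_def)
  then show ?thesis using assms
    by (intro flip_completes[of 0 N b r 2]) (auto simp: numeral_2_eq_2)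
qed

lemma full_chain_flip_last:
  assumes "top_row b (Suc x) = r" "top_row b x = r"
  shows "\<not> no_full_chain r (Suc x) (flip (Suc x) b)"
proof -
  obtain C e where C: "e \<le> x" "chain b r C e" "b r e = b r x"
    using chain_top_row[of x b] assms(2) by metis
  have "b r x = b r (Suc x)" using assms by (auto split: if_splits)
  with C have "flip (Suc x) b r e \<noteq> flip (Suc x) b r (Suc x)" by (auto simp: flip_def)
  moreover have "chain (flip (Suc x) b) r C e"
    by (rule chain_cong[OF C(2)]) (use C(1) in \<open>auto simp: flip_def\<close>)
  ultimately have "chain (flip (Suc x) b) (Suc r) (insert (Suc x) C) (Suc x)"
    using C(1) by (intro chain.step[of _ _ _ e]) auto
  then show ?thesis unfolding no_full_chain_def by fastforce
qed

section \<open>A potential that pays for facets\<close>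

text \<open>
  Every step of a staircase pays for one wall. In addition a wall may be caused by the fact that \<open>T\<close>
  has just stepped (\<open>c\<close>) while the staircases come close to each other, and this happens at most once for every two rows:
  hence the third summand. The first correction is an advance on that summand: for \<open>T = 2m\<close> and \<open>B = 2m + 1\<close> the
  staircases are already close, but \<open>T\<close> is one row short of increasing \<open>(T - 1) div 2\<close>. The second one reserves
  the payment for the column right after a step of \<open>T\<close>.
\<close>
definition potential :: "nat \<Rightarrow> nat \<Rightarrow> bool \<Rightarrow> nat \<Rightarrow> int" where
  "potential T B c j = int (T + B + (T - 1) div 2)
     + (if even T \<and> B = Suc T \<and> (T < 2 * j \<or> T = 2 * j \<and> c) then 1 else 0)
     - (if c \<and> B \<le> Suc T then 1 else 0)"

lemma potential_odd:
  "potential (2 * m + 1) B c j = int (3 * m + 1 + B) - (if c \<and> B \<le> 2 * m + 2 then 1 else 0)"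
  by (simp add: potential_def)

lemma potential_even:
  "potential (2 * m + 2) B c j = int (3 * m + 2 + B)
     + (if B = 2 * m + 3 \<and> (m + 1 < j \<or> m + 1 = j \<and> c) then 1 else 0)
     - (if c \<and> B \<le> 2 * m + 3 then 1 else 0)"
  by (auto simp: potential_def)

text \<open>
  One column: \<open>t\<close> tells whether the signs of two neighbouring columns agree, so that rows up to the threshold
  \<open>2j\<close> keep their sign exactly if \<open>t\<close> holds. The condition \<open>free\<close> excludes that the staircases are at least
  two rows apart and none of them moves, the only way to get a wall without paying for it.
\<close>
lemma potential_step:
  assumes "1 \<le> T" "T \<le> B" "T' \<le> B'" "j' = j \<or> j' = Suc j"
    and T': "T' = (if t \<longleftrightarrow> T \<le> 2 * j then T else Suc T)"
    and B: "B = (if t \<longleftrightarrow> B' \<le> 2 * j then B' else B' - 1)"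
    and free: "\<not> (T + 2 \<le> B' \<and> T' = T \<and> B' = B)"
  shows "potential T B c j
      + (if c \<or> T + (if t \<longleftrightarrow> Suc T \<le> 2 * j then 1 else 0) < B' then 1 else 0)
    \<le> potential T' B' (T' \<noteq> T) j'"
proof -
  have "\<exists>m. T = 2 * m + 1 \<or> T = 2 * m + 2" using \<open>1 \<le> T\<close> by presburger
  then obtain m where m: "T = 2 * m + 1 \<or> T = 2 * m + 2" by blast
  have B': "B' = B \<and> (t \<longleftrightarrow> B \<le> 2 * j) \<or> B' = B + 1 \<and> \<not> (t \<longleftrightarrow> B + 1 \<le> 2 * j)"
    using B assms(1-3) by (cases "t \<longleftrightarrow> B' \<le> 2 * j") auto
  have T'': "T' = T \<and> (t \<longleftrightarrow> T \<le> 2 * j) \<or> T' = T + 1 \<and> \<not> (t \<longleftrightarrow> T \<le> 2 * j)"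
    using T' by auto
  from m show ?thesis
  proof
    assume T: "T = 2 * m + 1"
    from T'' show ?thesis
    proof (elim disjE conjE)
      assume e: "T' = T" "t \<longleftrightarrow> T \<le> 2 * j"
      show ?thesis using B' free assms(2) e unfolding T e(1) potential_odd
        by (elim disjE conjE; cases c; cases t; simp; linarith?)
    next
      assume e: "T' = T + 1" "\<not> (t \<longleftrightarrow> T \<le> 2 * j)"
      have T2: "T' = 2 * m + 2" using e T by simp
      show ?thesis using B' assms(2,3,4) e(2) unfolding T2 T potential_odd potential_even
        by (elim disjE conjE; cases c; cases t; simp; linarith?)
    qed
  next
    assume T: "T = 2 * m + 2"
    from T'' show ?thesis
    proof (elim disjE conjE)
      assume e: "T' = T" "t \<longleftrightarrow> T \<le> 2 * j"
      show ?thesis using B' free assms(2,4) e unfolding T e(1) potential_even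
        by (elim disjE conjE; cases c; cases t; simp; linarith?)
    next
      assume e: "T' = T + 1" "\<not> (t \<longleftrightarrow> T \<le> 2 * j)"
      have T2: "T' = 2 * (m + 1) + 1" using e T by simp
      show ?thesis using B' assms(2,3,4) e(2) unfolding T2 T potential_odd potential_even
        by (elim disjE conjE; cases c; cases t; simp; linarith?)
    qed
  qed
qed

declare top_row.simps(2) [simp del]

text \<open>
  The sign matrix \<open>b\<close> of a cell, with columns \<open>0, \<dots>, N\<close>. Its only special feature is the assumption
  \<open>threshold\<close>: from column \<open>x\<close> to column \<open>x + 1\<close>, either exactly the rows \<open>k \<le> 2 J(x)\<close> or exactly the
  rows \<open>k > 2 J(x)\<close> keep their signs.
\<close>
locale threshold_tope =
  fixes b :: "nat \<Rightarrow> nat \<Rightarrow> bool" and N r p :: nat and J :: "nat \<Rightarrow> nat" and t :: "nat \<Rightarrow> bool"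
  assumes no_full_chain: "no_full_chain r N b"
    and N: "1 \<le> N" and r: "1 \<le> r" and p: "p = (r - 1) div 2"
    and threshold: "\<And>x k. x < N \<Longrightarrow> b k x = b k (Suc x) \<longleftrightarrow> (t x \<longleftrightarrow> k \<le> 2 * J x)"
    and J_bounds: "\<And>x. 1 \<le> J x" "\<And>x. J x \<le> p"
    and J_step: "\<And>x. J (Suc x) = J x \<or> J (Suc x) = Suc (J x)"
begin

abbreviation T where "T \<equiv> top_row b"
abbreviation B where "B \<equiv> bot_row b r N"

text \<open>
  Column \<open>0\<close> counts as a column where \<open>T\<close> has just stepped, unless \<open>B\<close> starts in row \<open>1\<close> as well. With
  this convention the first column obeys the same accounting as all others.
\<close>
definition corner :: "nat \<Rightarrow> bool" where
  "corner x \<longleftrightarrow> (case x of 0 \<Rightarrow> B 0 \<noteq> 1 | Suc y \<Rightarrow> T (Suc y) \<noteq> T y)"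

lemma corner_Suc: "corner (Suc x) \<longleftrightarrow> T (Suc x) \<noteq> T x"
  by (simp add: corner_def)

definition facets :: "nat set" where
  "facets = {x. x \<le> N \<and> no_full_chain r N (flip x b)}"

definition level :: "nat \<Rightarrow> int" where
  "level x = potential (T x) (B x) (corner x) (J x)"

text \<open>
  The columns that may be walls for free. Since neither staircase moves, the rows of \<open>T\<close> and \<open>B\<close> lie on the same
  side of the threshold.
\<close>
definition stalled :: "nat \<Rightarrow> bool" where
  "stalled x \<longleftrightarrow> x < N \<and> T x + 2 \<le> B (Suc x) \<and> T (Suc x) = T x \<and> B (Suc x) = B x"

lemma T_ge: "1 \<le> T x"
  by (induction x) (auto simp: top_row.simps(2))

lemma T_le_B: "x \<le> N \<Longrightarrow> T x \<le> B x"
  by (rule top_row_le_bot_row[OF no_full_chain r])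

lemma T_Suc: "x < N \<Longrightarrow> T (Suc x) = (if t x \<longleftrightarrow> T x \<le> 2 * J x then T x else Suc (T x))"
  using threshold[of x "T x"] by (simp add: top_row.simps(2))

lemma B_Suc: "x < N \<Longrightarrow> B x = (if t x \<longleftrightarrow> B (Suc x) \<le> 2 * J x then B (Suc x) else B (Suc x) - 1)"
  using threshold[of x "B (Suc x)"] bot_row_step[of x N b r] by simp

lemma B_mono: "x \<le> y \<Longrightarrow> y \<le> N \<Longrightarrow> B x \<le> B y"
proof (induction y)
  case (Suc y)
  then show ?case
    using B_Suc[of y] by (cases "x = Suc y") (auto split: if_splits)
qed simp

lemma B_le: "x \<le> N \<Longrightarrow> B x \<le> r"
  using B_mono[of x N] by simp

text \<open>
  \<open>potential_step\<close> pays for all columns where \<open>T\<close> has just stepped or \<open>B(x + 1)\<close> exceeds \<open>T(x)\<close> by enough;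
  the other columns are not walls by \<open>full_chain_flip_inner\<close> and, for the first column, \<open>full_chain_flip_first\<close>.
\<close>
lemma level_step:
  assumes "x < N" "\<not> stalled x"
  shows "level x + (if x \<in> facets then 1 else 0) \<le> level (Suc x)"
proof -
  have TB: "T x \<le> B x" "T (Suc x) \<le> B (Suc x)" using T_le_B[of x] T_le_B[of "Suc x"] assms by auto
  note c = corner_Suc[of x]
  have *: "level x + (if corner x \<or> T x + (if t x \<longleftrightarrow> Suc (T x) \<le> 2 * J x then 1 else 0) < B (Suc x)
      then 1 else 0) \<le> level (Suc x)"
    unfolding level_def c using TB T_ge[of x] assms J_step[of x] T_Suc[of x] B_Suc[of x]
    by (intro potential_step) (auto simp: stalled_def)
  show ?thesis
  proof (cases "x \<in> facets \<and> \<not> (corner x \<or>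
      T x + (if t x \<longleftrightarrow> Suc (T x) \<le> 2 * J x then 1 else 0) < B (Suc x))")
    case False
    then show ?thesis using * by (auto split: if_splits)
  next
    case True
    show ?thesis
    proof (cases x)
      case (Suc y)
      have "T (Suc y) = T y" using True Suc by (simp add: corner_def)
      moreover have "B (Suc (Suc y)) \<le> T y + (if b (Suc (T y)) (Suc y) = b (Suc (T y)) (Suc (Suc y)) then 1 else 0)"
        using True Suc threshold[of x "Suc (T x)"] assms(1) \<open>T (Suc y) = T y\<close> by auto
      ultimately have "\<not> no_full_chain r N (flip x b)"
        using full_chain_flip_inner[OF no_full_chain r, of y] assms(1) Suc by simp
      with True show ?thesis by (simp add: facets_def)
    next
      case 0
      have B0: "B 0 = 1" using True 0 by (simp add: corner_def)
      have "B 1 \<noteq> 1"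
      proof
        assume "B 1 = 1"
        then have "t 0" using B_Suc[of 0] B0 assms 0 J_bounds(1)[of 0] by (auto split: if_splits)
        then have "b 1 0 = b 1 1" using threshold[of 0 1] assms 0 J_bounds(1)[of 0] by simp
        then show False
          using full_chain_flip_first[of N r b] \<open>B 1 = 1\<close> True 0 N r by (simp add: facets_def)
      qed
      then have "B 1 = 2" "\<not> t 0"
        using B_Suc[of 0] B0 assms 0 J_bounds(1)[of 0] by (auto split: if_splits)
      moreover have "T 1 = 2" using T_Suc[of 0] \<open>\<not> t 0\<close> assms 0 J_bounds(1)[of 0] by simp
      ultimately show ?thesis using B0 True 0
        by (simp add: level_def potential_def corner_def)
    qed
  qed
qed

definition count :: "nat \<Rightarrow> nat \<Rightarrow> int" where
  "count i k = (\<Sum>x=i..<k. if x \<in> facets then 1 else 0)"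

lemma count_split: "i \<le> j \<Longrightarrow> j \<le> k \<Longrightarrow> count i k = count i j + count j k"
  unfolding count_def by (simp add: sum.atLeastLessThan_concat)

lemma count_le: "i \<le> k \<Longrightarrow> count i k \<le> int k - int i"
proof -
  assume "i \<le> k"
  have "count i k \<le> (\<Sum>x=i..<k. 1)" unfolding count_def by (intro sum_mono) auto
  with \<open>i \<le> k\<close> show ?thesis by simp
qed

lemma count_level:
  assumes "i \<le> k" "k \<le> N" "\<And>x. i \<le> x \<Longrightarrow> x < k \<Longrightarrow> \<not> stalled x"
  shows "count i k \<le> level k - level i"
  using assms
proof (induction k rule: dec_induct)
  case base
  then show ?case by (simp add: count_def)
next
  case (step k)
  have "count i k \<le> level k - level i" using step by auto
  moreover have "count i (Suc k) = count i k + (if k \<in> facets then 1 else 0)"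
    using step(1) by (simp add: count_def)
  ultimately show ?case using level_step[of k] step by simp
qed

text \<open>
  The potential increases from at least \<open>2\<close> to at most \<open>2r + p\<close>, the last column included, where \<open>p = \<lfloor>d/2\<rfloor>\<close> and \<open>r = d + 1\<close>; without stalls there are
  therefore at most \<open>2d + p\<close> walls.
\<close>
lemma level_first: "2 \<le> level 0"
  using T_le_B[of 0] by (auto simp: level_def potential_def corner_def)

lemma level_last: "level N + count N (Suc N) \<le> 2 * int r + int p"
proof -
  have TN: "T N \<le> r" using top_row_le[OF no_full_chain r] by simp
  have c: "count N (Suc N) = (if N \<in> facets then 1 else 0)" by (simp add: count_def)
  obtain M where M: "N = Suc M" using N by (cases N) auto
  show ?thesis
  proof (cases "T N = r")
    case True
    have "N \<notin> facets" if "\<not> corner N"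
    proof -
      have "T (Suc M) = T M" using that M corner_Suc by metis
      then have "\<not> no_full_chain r N (flip N b)"
        using True M full_chain_flip_last[of b M r] by metis
      then show ?thesis by (simp add: facets_def)
    qed
    moreover have "level N = 2 * int r + int p - (if corner N then 1 else 0)"
      using True r unfolding level_def potential_def p by simp
    ultimately show ?thesis unfolding c by auto
  next
    case False
    with TN have l: "Suc (T N) \<le> r" by simp
    have d: "(T N - 1) div 2 \<le> p" unfolding p using l by (intro div_le_mono) simp
    have J: "2 * J N \<le> r - 1" using J_bounds(2)[of N] p by linarith
    then have nb: "\<not> (r = Suc (T N) \<and> T N < 2 * J N)" by auto
    have "level N \<le> int (T N + r + (T N - 1) div 2)"
      using nb unfolding level_def potential_def by auto
    moreover have "int ((T N - 1) div 2) \<le> int p" using d by simp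
    ultimately show ?thesis using l unfolding c by auto
  qed
qed

lemma stalled_cases:
  assumes "stalled x"
  obtains (above) "2 * J x < T x" | (below) "B x \<le> 2 * J x"
proof (cases "2 * J x < T x")
  case False
  have x: "x < N" "T (Suc x) = T x" "B (Suc x) = B x" "0 < B x"
    using assms by (auto simp: stalled_def)
  have "t x" using T_Suc[OF x(1)] x(2) False by (metis n_not_Suc_n not_less)
  then have "B x \<le> 2 * J x" using B_Suc[OF x(1)] x(3,4) by (metis diff_less less_irrefl zero_less_one)
  then show thesis by (rule below)
qed (rule above)

text \<open>
  A stall above the threshold happens at a high potential, a stall below it at a low one. Each block of
  the threshold accounts for five units of potential.
\<close>
lemma level_after_above:
  assumes "stalled x" "2 * J x < T x"
  shows "5 * int (J x) + 4 \<le> level (Suc x)" "J x < p"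
proof -
  have T: "T (Suc x) = T x" "B (Suc x) = B x" "T x + 2 \<le> B x" "\<not> corner (Suc x)" "x < N"
    using assms(1) by (auto simp: stalled_def corner_def)
  have "J x \<le> (T x - 1) div 2" using assms(2) by linarith
  then show "5 * int (J x) + 4 \<le> level (Suc x)"
    using T assms(2) by (auto simp: level_def potential_def)
  have "2 * J x + 3 \<le> r" using T assms(2) B_le[of x] by simp
  then show "J x < p" unfolding p by linarith
qed

lemma level_before_below:
  assumes "stalled x" "B x \<le> 2 * J x"
  shows "level x \<le> 5 * int (J x) - 4" "2 \<le> J x"
proof -
  have T: "T x + 2 \<le> B x" "1 \<le> T x" using assms(1) T_ge by (auto simp: stalled_def)
  show "2 \<le> J x" using T assms(2) by simp
  have "int ((T x - 1) div 2) \<le> int (J x) - 2" using T assms(2) by linarith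
  then show "level x \<le> 5 * int (J x) - 4"
    using T assms(2) by (auto simp: level_def potential_def)
qed

text \<open>
  \<open>lower\<close> and \<open>upper\<close> say that the first block of columns with constant threshold has \<open>L + 4\<close> columns and every
  later one, except perhaps the last, \<open>5 + e\<close>. Look at the first stall below the threshold, if there is one, and
  at the last stall before it, which is above the threshold. Between these two columns, or from the first column on, or up to
  the last column, no stall occurs and the number of walls is bounded by the difference of the potentials. The blocks
  in between have too many columns for that: if they include the first block, at least \<open>L\<close> of the columns are not
  walls, and otherwise at least \<open>3 + e\<close>.
\<close>
theorem card_facets:
  fixes L e :: nat
  assumes L: "L \<le> e + 3"
    and lower: "\<And>x. 2 \<le> J x \<Longrightarrow> L + 5 * J x + (J x - 2) * e \<le> x + 6"
    and upper: "\<And>x. J x < p \<Longrightarrow> x + 2 \<le> L + 5 * J x + (J x - 1) * e"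
    and size: "L + 2 * (r - 1) + p + (p - 1) * e \<le> Suc N"
  shows "card facets + L \<le> Suc N"
proof -
  have tot: "int (card facets) = count 0 (Suc N)"
  proof -
    have "facets \<subseteq> {0..<Suc N}" by (auto simp: facets_def)
    then have "count 0 (Suc N) = (\<Sum>x\<in>facets. 1)"
      unfolding count_def by (intro sum.mono_neutral_cong_right) auto
    then show ?thesis by simp
  qed
  define extra where "extra j = int (j - 1) * int e" for j
  have extra_ge: "0 \<le> extra j" for j by (simp add: extra_def)
  have extra_Suc: "extra (j + 1 + k) = extra j + int e + int k * int e" if "1 \<le> j" for j k
  proof -
    have "j + 1 + k - 1 = (j - 1) + 1 + k" using that by simp
    then show ?thesis unfolding extra_def by (simp add: algebra_simps)
  qed
  have lower': "int L + 5 * int (J x) + extra (J x - 1) \<le> int x + 6" if "2 \<le> J x" for x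
  proof -
    have eq: "J x - 2 = J x - 1 - 1" by simp
    show ?thesis
      unfolding extra_def using iffD2[OF of_nat_le_iff lower[OF that, unfolded eq]]
      by (simp only: of_nat_add of_nat_mult of_nat_numeral)
  qed
  have upper': "int x + 2 \<le> int L + 5 * int (J x) + extra (J x)" if "J x < p" for x
    unfolding extra_def using iffD2[OF of_nat_le_iff upper[OF that]]
    by (simp only: of_nat_add of_nat_mult of_nat_numeral)
  have size': "int L + 2 * int r - 2 + int p + extra p \<le> int (Suc N)"
  proof -
    have "int L + 2 * int (r - 1) + int p + extra p \<le> int (Suc N)"
      unfolding extra_def using iffD2[OF of_nat_le_iff size] by (simp only: of_nat_add of_nat_mult of_nat_numeral)
    moreover have "2 * int (r - 1) = 2 * int r - 2" using r by simp
    ultimately show ?thesis by linarith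
  qed
  have split: "count 0 (Suc N) = count 0 N + count N (Suc N)" by (rule count_split) simp_all
  have "count 0 (Suc N) + int L \<le> int (Suc N)"
  proof (cases "\<exists>y. stalled y \<and> B y \<le> 2 * J y")
    case True
    define y where "y = (LEAST y. stalled y \<and> B y \<le> 2 * J y)"
    have y: "stalled y" "B y \<le> 2 * J y" unfolding y_def using LeastI_ex[OF True] by auto
    have least: "\<And>z. z < y \<Longrightarrow> stalled z \<Longrightarrow> \<not> B z \<le> 2 * J z"
      unfolding y_def using not_less_Least by blast
    have yN: "y < N" using y(1) by (simp add: stalled_def)
    note ly = level_before_below[OF y]
    have after: "count y (Suc N) \<le> int (Suc N) - int y" by (rule count_le) (use yN in simp)
    show ?thesis
    proof (cases "\<exists>x<y. stalled x")
      case False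
      have "count 0 y \<le> level y - level 0"
        by (rule count_level) (use False yN in auto)
      moreover have "count 0 (Suc N) = count 0 y + count y (Suc N)"
        by (rule count_split) (use yN in auto)
      moreover note lower'[OF ly(2)] extra_ge[of "J y - 1"]
      ultimately show ?thesis using after ly(1) level_first by linarith
    next
      case True
      define x where "x = Max {x. x < y \<and> stalled x}"
      have fin: "finite {x. x < y \<and> stalled x}" by simp
      have ne: "{x. x < y \<and> stalled x} \<noteq> {}" using True by auto
      have x: "x < y" "stalled x" unfolding x_def using Max_in[OF fin ne] by auto
      have between: "\<not> stalled z" if "Suc x \<le> z" "z < y" for z
        using Max_ge[OF fin, of z] that unfolding x_def[symmetric] by auto
      have ab: "2 * J x < T x" by (rule stalled_cases[OF x(2)]) (use least[OF x] in auto)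
      note lx = level_after_above[OF x(2) ab]
      have "count (Suc x) y \<le> level y - level (Suc x)"
        by (rule count_level) (use x yN between in auto)
      moreover have "count 0 (Suc N) = count 0 (Suc x) + (count (Suc x) y + count y (Suc N))"
        using count_split[of 0 "Suc x" "Suc N"] count_split[of "Suc x" y "Suc N"] x yN by simp
      moreover have "count 0 (Suc x) \<le> int (Suc x)" using count_le[of 0 "Suc x"] by simp
      moreover have "J x + 2 \<le> J y"
        using ab y(2) x(2) B_mono[of x y] x(1) yN by (auto simp: stalled_def)
      then obtain k where k: "J y = J x + 2 + k" using le_Suc_ex by blast
      moreover note lower'[OF ly(2)] upper'[OF lx(2)]
      moreover have "extra (J y - 1) = extra (J x) + int e + int k * int e"
      proof -
        have "J y - 1 = J x + 1 + k" using k by simp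
        then show ?thesis using extra_Suc[OF J_bounds(1)[of x], of k] by simp
      qed
      moreover have "0 \<le> int k * int e" by simp
      ultimately show ?thesis using after ly(1) lx(1) iffD2[OF of_nat_le_iff[where 'a = int] L]
        by (simp only: of_nat_add of_nat_Suc of_nat_numeral)
    qed
  next
    case nobelow: False
    show ?thesis
    proof (cases "\<exists>x. stalled x")
      case False
      have "count 0 N \<le> level N - level 0" by (rule count_level) (use False in auto)
      moreover note extra_ge[of p]
      ultimately show ?thesis using split level_first level_last size'
        by (simp only: of_nat_add of_nat_Suc of_nat_numeral)
    next
      case True
      define x where "x = Max {x. stalled x}"
      have fin: "finite {x. stalled x}" by (rule finite_subset[of _ "{..<N}"]) (auto simp: stalled_def)
      have ne: "{x. stalled x} \<noteq> {}" using True by auto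
      have x: "stalled x" unfolding x_def using Max_in[OF fin ne] by auto
      have after: "\<not> stalled z" if "Suc x \<le> z" for z
        using Max_ge[OF fin, of z] that unfolding x_def[symmetric] by auto
      have xN: "x < N" using x by (simp add: stalled_def)
      have ab: "2 * J x < T x" by (rule stalled_cases[OF x]) (use nobelow x in auto)
      note lx = level_after_above[OF x ab]
      have "count (Suc x) N \<le> level N - level (Suc x)"
        by (rule count_level) (use xN after in auto)
      moreover have "count 0 (Suc N) = count 0 (Suc x) + (count (Suc x) N + count N (Suc N))"
        using count_split[of 0 "Suc x" "Suc N"] count_split[of "Suc x" N "Suc N"] xN by simp
      moreover have "count 0 (Suc x) \<le> int (Suc x)" using count_le[of 0 "Suc x"] by simp
      moreover note upper'[OF lx(2)]
      moreover obtain k where k: "p = J x + 1 + k" using less_imp_Suc_add[OF lx(2)] by auto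
      have "extra p = extra (J x) + int e + int k * int e"
        using extra_Suc[OF J_bounds(1)[of x], of k] by (simp only: k)
      moreover have "0 \<le> int k * int e" by simp
      moreover note size'
      ultimately show ?thesis using lx(1) level_last iffD2[OF of_nat_le_iff[where 'a = int] L]
        by (simp only: of_nat_add of_nat_Suc of_nat_numeral)
    qed
  qed
  with tot show ?thesis by linarith
qed

end

section \<open>Vectors with a prescribed sign matrix\<close>

text \<open>
  Choices of signs are represented by the set \<open>P\<close> of columns with positive sign; for the finitely many
  columns in play there are then only finitely many of them.
\<close>
definition sg :: "nat set \<Rightarrow> nat \<Rightarrow> real" where
  "sg P i = (if i \<in> P then 1 else - 1)"

definition pattern :: "(nat \<Rightarrow> nat \<Rightarrow> bool) \<Rightarrow> nat set \<Rightarrow> nat \<Rightarrow> nat \<Rightarrow> bool" where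
  "pattern a P k i \<longleftrightarrow> (i \<in> P \<longleftrightarrow> a k i)"

text \<open>
  \<open>V i m\<close> is the \<open>m\<close>-th coordinate of the \<open>i\<close>-th vector. For \<open>k = card C\<close> the condition says that the vectors in \<open>C\<close>,
  truncated to their first \<open>k\<close> coordinates, form a basis of \<open>\<real>\<^sup>k\<close>.
\<close>
definition unisolvent :: "(nat \<Rightarrow> nat \<Rightarrow> real) \<Rightarrow> nat set \<Rightarrow> nat \<Rightarrow> bool" where
  "unisolvent V C k \<longleftrightarrow>
     (\<forall>y. \<exists>h. \<forall>m\<in>{1..k}. (\<Sum>i\<in>C. h i * V i m) = y m) \<and>
     (\<forall>u. (\<forall>m\<in>{1..k}. (\<Sum>i\<in>C. u i * V i m) = 0) \<longrightarrow> (\<forall>i\<in>C. u i = 0))"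

definition balanced :: "(nat \<Rightarrow> nat \<Rightarrow> real) \<Rightarrow> nat set \<Rightarrow> nat set \<Rightarrow> nat \<Rightarrow> (nat \<Rightarrow> real) \<Rightarrow> bool" where
  "balanced V P C k c \<longleftrightarrow>
     (\<forall>i\<in>C. 0 < c i) \<and> (\<forall>m\<in>{1..k}. (\<Sum>i\<in>C. c i * sg P i * V i m) = 0)"

text \<open>
  Adding a vector and a coordinate keeps the basis property as soon as the new coordinate of the new vector avoids
  the single value that would make it a combination of the old vectors.
\<close>
lemma unisolvent_insert:
  assumes "unisolvent V C k" "finite C" "q \<notin> C"
    and h: "\<And>m. m \<in> {1..k} \<Longrightarrow> (\<Sum>i\<in>C. h i * V i m) = V q m"
    and ne: "V q (Suc k) \<noteq> (\<Sum>i\<in>C. h i * V i (Suc k))"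
  shows "unisolvent V (insert q C) (Suc k)"
  unfolding unisolvent_def
proof (intro conjI allI impI)
  fix y
  define d where "d = V q (Suc k) - (\<Sum>i\<in>C. h i * V i (Suc k))"
  have d: "d \<noteq> 0" using ne by (simp add: d_def)
  obtain g where g: "\<And>m. m \<in> {1..k} \<Longrightarrow> (\<Sum>i\<in>C. g i * V i m) = y m"
    using assms(1) unfolding unisolvent_def by (elim conjE) (drule spec[of _ y], blast)
  define z where "z = (y (Suc k) - (\<Sum>i\<in>C. g i * V i (Suc k))) / d"
  define h' where "h' = (\<lambda>i. if i = q then z else g i - z * h i)"
  have eq: "(\<Sum>i\<in>insert q C. h' i * V i m) =
      z * V q m + (\<Sum>i\<in>C. g i * V i m) - z * (\<Sum>i\<in>C. h i * V i m)" for m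
  proof -
    have "(\<Sum>i\<in>C. h' i * V i m) = (\<Sum>i\<in>C. g i * V i m - z * (h i * V i m))"
      using assms(3) by (intro sum.cong) (auto simp: h'_def algebra_simps)
    then show ?thesis using assms(2,3) by (simp add: h'_def sum_subtractf sum_distrib_left)
  qed
  have "(\<Sum>i\<in>insert q C. h' i * V i m) = y m" if "m \<in> {1..Suc k}" for m
  proof (cases "m = Suc k")
    case True
    have "z * d = y (Suc k) - (\<Sum>i\<in>C. g i * V i (Suc k))" using d by (simp add: z_def)
    then show ?thesis unfolding eq True d_def by (simp add: algebra_simps)
  next
    case False
    then have "m \<in> {1..k}" using that by auto
    then show ?thesis unfolding eq using g h by simp
  qed
  then show "\<exists>h. \<forall>m\<in>{1..Suc k}. (\<Sum>i\<in>insert q C. h i * V i m) = y m" by blast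
next
  fix u
  assume u: "\<forall>m\<in>{1..Suc k}. (\<Sum>i\<in>insert q C. u i * V i m) = 0"
  have s: "(\<Sum>i\<in>C. (u i + u q * h i) * V i m) = (\<Sum>i\<in>C. u i * V i m) + u q * (\<Sum>i\<in>C. h i * V i m)" for m
    by (simp add: algebra_simps sum.distrib sum_distrib_left)
  have "(\<Sum>i\<in>C. (u i + u q * h i) * V i m) = 0" if "m \<in> {1..k}" for m
    unfolding s using u[rule_format, of m] that h[OF that] assms(2,3) by simp
  moreover have "(\<forall>m\<in>{1..k}. (\<Sum>i\<in>C. (u i + u q * h i) * V i m) = 0) \<longrightarrow> (\<forall>i\<in>C. u i + u q * h i = 0)"
    using assms(1) unfolding unisolvent_def by (elim conjE) (erule spec)
  ultimately have z: "u i + u q * h i = 0" if "i \<in> C" for i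
    using that by simp
  then have "(\<Sum>i\<in>C. (u i + u q * h i) * V i (Suc k)) = 0" by (intro sum.neutral) auto
  moreover have "u q * V q (Suc k) + (\<Sum>i\<in>C. u i * V i (Suc k)) = 0"
    using u[rule_format, of "Suc k"] assms(2,3) by simp
  ultimately have "u q * (V q (Suc k) - (\<Sum>i\<in>C. h i * V i (Suc k))) = 0"
    unfolding s right_diff_distrib by linarith
  then have "u q = 0" using ne by simp
  with z show "\<forall>i\<in>insert q C. u i = 0" by simp
qed

text \<open>
  How a chain grows by one column \<open>q\<close>. The weights \<open>c\<close> cancel all coordinates but the last one, where their sum
  has the sign opposite to that of the new vector. Hence a multiple of \<open>c\<close> cancels the new vector in coordinate \<open>k\<close>.
  The lower coordinates are repaired by the fixed correction \<open>h\<close>, which vanishes in coordinate \<open>k\<close>; if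
  the new coordinate \<open>s * t\<close> is huge, so is the multiple of \<open>c\<close>, and the corrected weights remain positive.
\<close>
lemma eventually_balanced_insert:
  assumes uni: "unisolvent V C k" and C: "finite C" "q \<notin> C" and k: "1 \<le> k"
    and c: "\<forall>i\<in>C. 0 < c i" "\<forall>m\<in>{1..<k}. (\<Sum>i\<in>C. c i * sg P i * V i m) = 0"
    and s: "s = 1 \<or> s = - 1"
    and tilt: "(\<Sum>i\<in>C. c i * sg P i * V i k) * (sg P q * s) < 0"
  shows "\<forall>\<^sub>F t in at_top. \<exists>c'. balanced (V(q := v(k := s * t))) P (insert q C) k c'"
proof -
  define dl where "dl = (\<Sum>i\<in>C. c i * sg P i * V i k)"
  have sq: "sg P i * sg P i = 1" for i by (simp add: sg_def)
  have ss: "s * s = 1" using s by auto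
  have dl: "dl = - (sg P q * s) * \<bar>dl\<bar>" "dl \<noteq> 0"
    using tilt s unfolding dl_def[symmetric] by (auto simp: sg_def split: if_splits)
  obtain h where h: "\<And>m. m \<in> {1..k} \<Longrightarrow> (\<Sum>i\<in>C. h i * V i m) = (if m = k then 0 else - sg P q * v m)"
    using uni unfolding unisolvent_def
    by (elim conjE) (drule spec[of _ "\<lambda>m. if m = k then 0 else - sg P q * v m"], blast)
  define c' where "c' t = (\<lambda>i. if i = q then 1 else t / \<bar>dl\<bar> * c i + sg P i * h i)" for t
  have ev: "\<forall>\<^sub>F t in at_top. \<forall>i\<in>C. 0 < t / \<bar>dl\<bar> * c i + sg P i * h i"
  proof (rule eventually_ball_finite[OF C(1)], rule ballI)
    fix i assume "i \<in> C"
    then have pos: "0 < c i / \<bar>dl\<bar>" using c dl(2) by simp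
    have "filterlim (\<lambda>t. c i / \<bar>dl\<bar> * t) at_top at_top"
      by (rule filterlim_tendsto_pos_mult_at_top[OF tendsto_const pos filterlim_ident])
    then have "\<forall>\<^sub>F t in at_top. - (sg P i * h i) < c i / \<bar>dl\<bar> * t"
      by (rule filterlim_at_top_dense[THEN iffD1, rule_format])
    then show "\<forall>\<^sub>F t in at_top. 0 < t / \<bar>dl\<bar> * c i + sg P i * h i"
      by eventually_elim (simp add: algebra_simps)
  qed
  then show ?thesis
  proof eventually_elim
    case (elim t)
    let ?W = "V(q := v(k := s * t))"
    have "balanced ?W P (insert q C) k (c' t)"
      unfolding balanced_def
    proof (intro conjI ballI)
      fix i assume "i \<in> insert q C"
      then show "0 < c' t i" using elim by (auto simp: c'_def)
    next
      fix m assume m: "m \<in> {1..k}"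
      have "(\<Sum>i\<in>C. c' t i * sg P i * ?W i m) =
          (\<Sum>i\<in>C. t / \<bar>dl\<bar> * (c i * sg P i * V i m) + h i * V i m)"
      proof (intro sum.cong refl)
        fix i assume "i \<in> C"
        then have "i \<noteq> q" using C by auto
        then have "c' t i * sg P i * ?W i m = t / \<bar>dl\<bar> * (c i * sg P i * V i m) + (sg P i * sg P i) * (h i * V i m)"
          by (simp add: c'_def algebra_simps)
        then show "c' t i * sg P i * ?W i m = t / \<bar>dl\<bar> * (c i * sg P i * V i m) + h i * V i m"
          unfolding sq by simp
      qed
      also have "\<dots> = t / \<bar>dl\<bar> * (\<Sum>i\<in>C. c i * sg P i * V i m) + (\<Sum>i\<in>C. h i * V i m)"
        by (simp add: sum.distrib sum_distrib_left)
      also have "\<dots> = - sg P q * (if m = k then s * t else v m)"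
      proof (cases "m = k")
        case True
        have "t / \<bar>dl\<bar> * dl = t / \<bar>dl\<bar> * (- (sg P q * s) * \<bar>dl\<bar>)" using dl(1) by metis
        also have "\<dots> = - sg P q * (s * t)" using dl(2) by simp
        finally show ?thesis using True h[OF m] by (simp add: dl_def)
      next
        case False
        with m have "m \<in> {1..<k}" by auto
        then show ?thesis using c(2) h[OF m] False by simp
      qed
      finally show "(\<Sum>i\<in>insert q C. c' t i * sg P i * ?W i m) = 0"
        using C by (simp add: c'_def)
    qed
    then show ?case by blast
  qed
qed

text \<open>
  The invariant carried along a chain that ends in column \<open>e\<close>: its signed vectors cancel with positive weights in the
  first \<open>k - 1\<close> coordinates, and coordinate \<open>k\<close> of the sum has the sign of the last vector.
\<close>
definition tilted :: "(nat \<Rightarrow> nat \<Rightarrow> bool) \<Rightarrow> (nat \<Rightarrow> nat \<Rightarrow> real) \<Rightarrow> nat set \<Rightarrow> nat set \<Rightarrow> nat \<Rightarrow> nat \<Rightarrow> bool" where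
  "tilted a V P C k e \<longleftrightarrow> (\<exists>c. balanced V P C (k - 1) c \<and>
      0 < (\<Sum>i\<in>C. c i * sg P i * V i k) * (if pattern a P k e then 1 else - 1))"

lemma unisolvent_cong:
  assumes "\<And>i m. i \<in> C \<Longrightarrow> 1 \<le> m \<Longrightarrow> m \<le> k \<Longrightarrow> V i m = W i m"
  shows "unisolvent V C k = unisolvent W C k"
proof -
  have "(\<Sum>i\<in>C. u i * V i m) = (\<Sum>i\<in>C. u i * W i m)" if "m \<in> {1..k}" for u m
    using that assms by (intro sum.cong) auto
  then show ?thesis unfolding unisolvent_def by simp
qed

lemma balanced_cong:
  assumes "\<And>i m. i \<in> C \<Longrightarrow> 1 \<le> m \<Longrightarrow> m \<le> k \<Longrightarrow> V i m = W i m"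
  shows "balanced V P C k c = balanced W P C k c"
proof -
  have "(\<Sum>i\<in>C. c i * sg P i * V i m) = (\<Sum>i\<in>C. c i * sg P i * W i m)" if "m \<in> {1..k}" for m
    using that assms by (intro sum.cong) auto
  then show ?thesis unfolding balanced_def by simp
qed

lemma tilted_cong:
  assumes "\<And>i m. i \<in> C \<Longrightarrow> 1 \<le> m \<Longrightarrow> m \<le> k \<Longrightarrow> V i m = W i m" "1 \<le> k"
  shows "tilted a V P C k e = tilted a W P C k e"
proof -
  have "(\<Sum>i\<in>C. c i * sg P i * V i k) = (\<Sum>i\<in>C. c i * sg P i * W i k)" for c
    using assms by (intro sum.cong) auto
  moreover have "balanced V P C (k - 1) c = balanced W P C (k - 1) c" for c
    using assms by (intro balanced_cong) auto
  ultimately show ?thesis unfolding tilted_def by simp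
qed

text \<open>
  For vectors in \<open>\<real>\<^sup>r\<close> the first clause contains general position. By the second one every chain of \<open>r + 1\<close>
  columns supports a positive dependency of the signed vectors, as it cancels them in the first \<open>r\<close> coordinates.
\<close>
definition realizes :: "(nat \<Rightarrow> nat \<Rightarrow> bool) \<Rightarrow> nat \<Rightarrow> (nat \<Rightarrow> nat \<Rightarrow> real) \<Rightarrow> bool" where
  "realizes a q V \<longleftrightarrow>
     (\<forall>C. C \<subseteq> {..<q} \<longrightarrow> unisolvent V C (card C)) \<and>
     (\<forall>P k C e. chain (pattern a P) k C e \<longrightarrow> e < q \<longrightarrow> tilted a V P C k e)"

lemma chain_subset: "chain b k C e \<Longrightarrow> C \<subseteq> {..e}"
  using chain_props by fastforce

lemma chain_restrict:
  assumes "chain (pattern a P) k C e" "e \<le> q"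
  shows "chain (pattern a (P \<inter> {..q})) k C e"
  by (rule chain_cong[OF assms(1)]) (use assms(2) in \<open>auto simp: pattern_def\<close>)

lemma balanced_restrict:
  assumes "C \<subseteq> {..q}"
  shows "balanced V (P \<inter> {..q}) C k c = balanced V P C k c"
proof -
  have "(\<Sum>i\<in>C. c i * sg (P \<inter> {..q}) i * V i m) = (\<Sum>i\<in>C. c i * sg P i * V i m)" for m
    using assms by (intro sum.cong) (auto simp: sg_def)
  then show ?thesis unfolding balanced_def by simp
qed

lemma tilted_restrict:
  assumes "C \<subseteq> {..q}" "e \<le> q"
  shows "tilted a V (P \<inter> {..q}) C k e = tilted a V P C k e"
proof -
  have "(\<Sum>i\<in>C. c i * sg (P \<inter> {..q}) i * V i m) = (\<Sum>i\<in>C. c i * sg P i * V i m)" for m c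
    using assms by (intro sum.cong) (auto simp: sg_def)
  moreover have "pattern a (P \<inter> {..q}) k e = pattern a P k e"
    using assms(2) by (simp add: pattern_def)
  ultimately show ?thesis using balanced_restrict[OF assms(1)] unfolding tilted_def by simp
qed

text \<open>
  The three requirements on coordinate \<open>k\<close> of a new vector \<open>v\<close> in column \<open>q\<close>. The third one prepares the chains
  of length \<open>k + 1\<close> that end in \<open>q\<close>.
\<close>
definition unisolvent_at where
  "unisolvent_at V q k v \<longleftrightarrow>
     (\<forall>C. C \<subseteq> {..<q} \<longrightarrow> card C = k - 1 \<longrightarrow> unisolvent (V(q := v)) (insert q C) k)"

definition tilted_at where
  "tilted_at a V q k v \<longleftrightarrow> (\<forall>P C. chain (pattern a P) k C q \<longrightarrow> tilted a (V(q := v)) P C k q)"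

definition balanced_at where
  "balanced_at a V q k v \<longleftrightarrow>
     (\<forall>P C e. chain (pattern a P) k C e \<longrightarrow> e < q \<longrightarrow> pattern a P k e \<noteq> pattern a P k q \<longrightarrow>
        (\<exists>c. balanced (V(q := v)) P (insert q C) k c))"

text \<open>
  The coordinates of the new vector are chosen one after the other. Each requirement concerns finitely many chains
  and holds once the coordinate, taken with its prescribed sign, is large enough.
\<close>
lemma realizes_coordinates:
  assumes V: "realizes a q V"
  shows "\<exists>v. \<forall>k\<in>{1..K}. unisolvent_at V q k v \<and> tilted_at a V q k v \<and> balanced_at a V q k v"
proof (induction K)
  case 0
  then show ?case by simp
next
  case (Suc K)
  then obtain v where v: "\<forall>k\<in>{1..K}. unisolvent_at V q k v \<and> tilted_at a V q k v \<and> balanced_at a V q k v"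
    by blast
  define k where "k = Suc K"
  define s :: real where "s = (if a k q then 1 else - 1)"
  have s: "s = 1 \<or> s = - 1" by (simp add: s_def)
  define W where "W t = V(q := v(k := s * t))" for t
  have WV: "W t i m = (V(q := v)) i m" if "m \<noteq> k" for t i m using that by (simp add: W_def)
  have WV': "W t i = V i" if "i \<noteq> q" for t i using that by (simp add: W_def)
  have big: "\<forall>\<^sub>F t in at_top. x < y * t" if "0 < y" for x y :: real
  proof -
    have "filterlim (\<lambda>t. y * t) at_top at_top"
      by (rule filterlim_tendsto_pos_mult_at_top[OF tendsto_const that filterlim_ident])
    then show ?thesis by (rule filterlim_at_top_dense[THEN iffD1, rule_format])
  qed
  have old: "unisolvent_at V q k' (v(k := s * t)) \<and> tilted_at a V q k' (v(k := s * t)) \<and>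
      balanced_at a V q k' (v(k := s * t))" if k': "k' \<in> {1..K}" for k' t
  proof -
    have eq: "W t i m = (V(q := v)) i m" if "m \<le> k'" for i m using WV that k' by (simp add: k_def)
    have "unisolvent (W t) C k' = unisolvent (V(q := v)) C k'" for C
      using eq by (intro unisolvent_cong)
    moreover have "balanced (W t) P C k' = balanced (V(q := v)) P C k'" for P C
      using eq by (intro ext balanced_cong)
    moreover have "tilted a (W t) P C k' q = tilted a (V(q := v)) P C k' q" for P C
      using eq k' by (intro tilted_cong) auto
    ultimately show ?thesis using bspec[OF v k'] unfolding W_def unisolvent_at_def tilted_at_def balanced_at_def by simp
  qed
  have A: "\<forall>\<^sub>F t in at_top. \<forall>C\<in>Pow {..<q}. card C = k - 1 \<longrightarrow> unisolvent (W t) (insert q C) k"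
  proof (rule eventually_ball_finite, simp, rule ballI)
    fix C assume C: "C \<in> Pow {..<q}"
    then have fin: "finite C" "q \<notin> C" by (auto intro: finite_subset)
    show "\<forall>\<^sub>F t in at_top. card C = k - 1 \<longrightarrow> unisolvent (W t) (insert q C) k"
    proof (cases "card C = K")
      case True
      have un: "unisolvent V C K" using V C True unfolding realizes_def by auto
      then obtain h where h: "\<And>m. m \<in> {1..K} \<Longrightarrow> (\<Sum>i\<in>C. h i * V i m) = v m"
        unfolding unisolvent_def by (elim conjE) (drule spec[of _ v], blast)
      have "\<forall>\<^sub>F t in at_top. \<bar>\<Sum>i\<in>C. h i * V i (Suc K)\<bar> < 1 * t" by (rule big) simp
      then show ?thesis
      proof eventually_elim
        case (elim t)
        have eqC: "(\<Sum>i\<in>C. h i * W t i m) = (\<Sum>i\<in>C. h i * V i m)" for m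
          using fin(2) WV' by (intro sum.cong refl) metis
        have "unisolvent (W t) (insert q C) (Suc K)"
        proof (rule unisolvent_insert[OF _ fin])
          show "unisolvent (W t) C K"
            using un fin WV' unisolvent_cong[of C K V "W t"] by metis
          show "(\<Sum>i\<in>C. h i * W t i m) = W t q m" if "m \<in> {1..K}" for m
            unfolding eqC using h[OF that] that by (simp add: W_def k_def)
          show "W t q (Suc K) \<noteq> (\<Sum>i\<in>C. h i * W t i (Suc K))"
            unfolding eqC using elim s by (auto simp: W_def k_def)
        qed
        then show ?case by (simp add: k_def)
      qed
    qed (simp add: k_def)
  qed
  have N: "\<forall>\<^sub>F t in at_top. \<forall>P\<in>Pow {..q}. \<forall>C\<in>Pow {..q}. chain (pattern a P) k C q \<longrightarrow> tilted a (W t) P C k q"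
  proof (rule eventually_ball_finite, simp, rule ballI, rule eventually_ball_finite, simp, rule ballI)
    fix P C assume P: "P \<in> Pow {..q}" and C: "C \<in> Pow {..q}"
    show "\<forall>\<^sub>F t in at_top. chain (pattern a P) k C q \<longrightarrow> tilted a (W t) P C k q"
    proof (cases "chain (pattern a P) k C q")
      case ch: True
      have C': "finite C" "q \<in> C" using chain_props[OF ch] by auto
      have "\<exists>c. balanced (V(q := v)) P C K c"
        using ch
      proof cases
        case start
        then show ?thesis by (intro exI[of _ "\<lambda>_. 1"]) (auto simp: balanced_def k_def)
      next
        case (step j D e)
        then have "K = j" by (simp add: k_def)
        moreover have "j \<in> {1..K}" using chain_props[OF step(3)] \<open>K = j\<close> by simp
        ultimately show ?thesis using bspec[OF v, of j] step unfolding balanced_at_def by blast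
      qed
      then obtain c where c: "balanced (V(q := v)) P C K c" by blast
      define p where "p = (if pattern a P k q then 1 else - 1 :: real)"
      have p: "sg P q * s * p = 1" by (auto simp: p_def s_def sg_def pattern_def)
      have "0 < c q" using c C' by (auto simp: balanced_def)
      then have "\<forall>\<^sub>F t in at_top. - ((\<Sum>i\<in>C-{q}. c i * sg P i * V i k) * p) < c q * t" by (rule big)
      then have "\<forall>\<^sub>F t in at_top. tilted a (W t) P C k q"
      proof eventually_elim
        case (elim t)
        have "balanced (W t) P C K c"
          using c balanced_cong[of C K "W t" "V(q := v)"] WV by (simp add: k_def)
        moreover have "(\<Sum>i\<in>C. c i * sg P i * W t i k) * p =
            c q * t + (\<Sum>i\<in>C-{q}. c i * sg P i * V i k) * p"
        proof -
          have "(\<Sum>i\<in>C. c i * sg P i * W t i k) = c q * sg P q * (s * t) + (\<Sum>i\<in>C-{q}. c i * sg P i * W t i k)"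
            using C' by (simp add: sum.remove[of C q] W_def)
          also have "(\<Sum>i\<in>C-{q}. c i * sg P i * W t i k) = (\<Sum>i\<in>C-{q}. c i * sg P i * V i k)"
            using WV' by (intro sum.cong) auto
          also have "(c q * sg P q * (s * t) + (\<Sum>i\<in>C-{q}. c i * sg P i * V i k)) * p =
              c q * t * (sg P q * s * p) + (\<Sum>i\<in>C-{q}. c i * sg P i * V i k) * p"
            by (simp add: algebra_simps)
          finally show ?thesis using p by simp
        qed
        ultimately show ?case using elim unfolding tilted_def p_def k_def by auto
      qed
      then show ?thesis by eventually_elim simp
    qed simp
  qed
  have Z: "\<forall>\<^sub>F t in at_top. \<forall>P\<in>Pow {..q}. \<forall>C\<in>Pow {..q}. \<forall>e\<in>{..<q}. chain (pattern a P) k C e \<longrightarrow>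
      pattern a P k e \<noteq> pattern a P k q \<longrightarrow> (\<exists>c. balanced (W t) P (insert q C) k c)"
  proof (rule eventually_ball_finite, simp, rule ballI, rule eventually_ball_finite, simp, rule ballI,
      rule eventually_ball_finite, simp, rule ballI)
    fix P C e assume P: "P \<in> Pow {..q}" and C: "C \<in> Pow {..q}" and e: "e \<in> {..<q}"
    show "\<forall>\<^sub>F t in at_top. chain (pattern a P) k C e \<longrightarrow>
      pattern a P k e \<noteq> pattern a P k q \<longrightarrow> (\<exists>c. balanced (W t) P (insert q C) k c)"
    proof (cases "chain (pattern a P) k C e \<and> pattern a P k e \<noteq> pattern a P k q")
      case True
      then have ch: "chain (pattern a P) k C e" by simp
      have C': "finite C" "card C = k" "C \<subseteq> {..<q}" "q \<notin> C"
        using chain_props[OF ch] e by force+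
      obtain c where c: "balanced V P C (k - 1) c"
          "0 < (\<Sum>i\<in>C. c i * sg P i * V i k) * (if pattern a P k e then 1 else - 1)"
        using V ch e unfolding realizes_def tilted_def by blast
      have "sg P q * s = - (if pattern a P k e then 1 else - 1)"
        using True by (auto simp: s_def sg_def pattern_def)
      then have "(\<Sum>i\<in>C. c i * sg P i * V i k) * (sg P q * s) < 0" using c(2) by simp
      moreover have "unisolvent V C k" using V C' unfolding realizes_def by auto
      ultimately have "\<forall>\<^sub>F t in at_top. \<exists>c'. balanced (V(q := v(k := s * t))) P (insert q C) k c'"
        using c(1) C' s by (intro eventually_balanced_insert) (auto simp: balanced_def k_def)
      then show ?thesis by eventually_elim (simp add: W_def)
    qed auto
  qed
  obtain t where t: "\<forall>C\<in>Pow {..<q}. card C = k - 1 \<longrightarrow> unisolvent (W t) (insert q C) k"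
      "\<forall>P\<in>Pow {..q}. \<forall>C\<in>Pow {..q}. chain (pattern a P) k C q \<longrightarrow> tilted a (W t) P C k q"
      "\<forall>P\<in>Pow {..q}. \<forall>C\<in>Pow {..q}. \<forall>e\<in>{..<q}. chain (pattern a P) k C e \<longrightarrow>
      pattern a P k e \<noteq> pattern a P k q \<longrightarrow> (\<exists>c. balanced (W t) P (insert q C) k c)"
    using eventually_happens'[OF trivial_limit_at_top_linorder eventually_conj[OF A eventually_conj[OF N Z]]]
    by (elim exE conjE) (rule that)
  have new_A: "unisolvent_at V q k (v(k := s * t))"
    using t(1) by (auto simp: W_def unisolvent_at_def)
  have new_N: "tilted_at a V q k (v(k := s * t))"
    unfolding tilted_at_def
  proof (intro allI impI)
    fix P C assume ch: "chain (pattern a P) k C q"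
    have "tilted a (W t) (P \<inter> {..q}) C k q"
      using t(2) chain_restrict[OF ch] chain_subset[OF ch] by blast
    then show "tilted a (V(q := v(k := s * t))) P C k q"
      using tilted_restrict[of C q] chain_subset[OF ch] by (simp add: W_def)
  qed
  have new_Z: "balanced_at a V q k (v(k := s * t))"
    unfolding balanced_at_def
  proof (intro allI impI)
    fix P C e assume ch: "chain (pattern a P) k C e" and e: "e < q" "pattern a P k e \<noteq> pattern a P k q"
    have sub: "C \<subseteq> {..q}" using chain_subset[OF ch] e(1) by force
    have "pattern a (P \<inter> {..q}) k e \<noteq> pattern a (P \<inter> {..q}) k q"
      using e by (simp add: pattern_def)
    then obtain c where "balanced (W t) (P \<inter> {..q}) (insert q C) k c"
      using t(3) chain_restrict[OF ch, of q] sub e(1) by fastforce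
    then show "\<exists>c. balanced (V(q := v(k := s * t))) P (insert q C) k c"
      using balanced_restrict[of "insert q C" q] sub by (auto simp: W_def)
  qed
  show ?case
  proof (rule exI[of _ "v(k := s * t)"], rule ballI)
    fix k' assume "k' \<in> {1..Suc K}"
    then consider "k' \<in> {1..K}" | "k' = k" unfolding k_def by force
    then show "unisolvent_at V q k' (v(k := s * t)) \<and> tilted_at a V q k' (v(k := s * t)) \<and>
      balanced_at a V q k' (v(k := s * t))"
      by cases (use old new_A new_N new_Z in blast)+
  qed
qed

theorem ex_realizes: "\<exists>V. realizes a q V"
proof (induction q)
  case 0
  show ?case by (rule exI[of _ "\<lambda>_ _. 0"]) (auto simp: realizes_def unisolvent_def)
next
  case (Suc q)
  then obtain V where V: "realizes a q V" by blast
  obtain v where v: "\<forall>k\<in>{1..Suc q}. unisolvent_at V q k v \<and> tilted_at a V q k v \<and> balanced_at a V q k v"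
    using realizes_coordinates[OF V, of "Suc q"] by blast
  have "realizes a (Suc q) (V(q := v))"
    unfolding realizes_def
  proof (intro conjI allI impI)
    fix C assume C: "C \<subseteq> {..<Suc q}"
    show "unisolvent (V(q := v)) C (card C)"
    proof (cases "q \<in> C")
      case True
      have D: "C - {q} \<subseteq> {..<q}" using C by auto
      have fin: "finite C" using C by (rule finite_subset) simp
      have "card C \<le> Suc q" using card_mono[OF _ C] by simp
      moreover have "card C \<ge> 1" using True fin by (auto simp: Suc_le_eq card_gt_0_iff)
      ultimately have "unisolvent_at V q (card C) v" using v by simp
      moreover have "card (C - {q}) = card C - 1" using True fin by simp
      ultimately have "unisolvent (V(q := v)) (insert q (C - {q})) (card C)"
        using D unfolding unisolvent_at_def by blast
      then show ?thesis using True by (simp add: insert_absorb)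
    next
      case False
      then have "C \<subseteq> {..<q}" using C by (auto simp: less_Suc_eq)
      moreover have "unisolvent V C (card C) = unisolvent (V(q := v)) C (card C)"
        using False by (intro unisolvent_cong) auto
      ultimately show ?thesis using V unfolding realizes_def by blast
    qed
  next
    fix P k C e
    assume ch: "chain (pattern a P) k C e" and e: "e < Suc q"
    note pr = chain_props[OF ch]
    show "tilted a (V(q := v)) P C k e"
    proof (cases "e = q")
      case True
      have "card C \<le> card {..q}" using chain_subset[OF ch] True by (intro card_mono) auto
      then have "tilted_at a V q k v" using v pr True by simp
      then show ?thesis using ch True unfolding tilted_at_def by simp
    next
      case False
      then have "tilted a V P C k e" using V ch e unfolding realizes_def by auto
      moreover have "tilted a V P C k e = tilted a (V(q := v)) P C k e"
        using pr False e by (intro tilted_cong) auto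
      ultimately show ?thesis by simp
    qed
  qed
  then show ?case by blast
qed

section \<open>From positive dependencies to few vertices\<close>

lemma face_number_0:
  "face_number 0 (P :: 'a::euclidean_space set) = card {v. v extreme_point_of P}"
proof -
  have "{F. F face_of P \<and> aff_dim F = int 0} = (\<lambda>v. {v}) ` {v. v extreme_point_of P}"
    by (auto simp: aff_dim_eq_0 face_of_singleton)
  then show ?thesis by (simp add: face_number_def card_image)
qed

lemma face_number_0_le:
  assumes "finite S" "convex hull S = convex hull (R :: 'a::euclidean_space set)"
  shows "face_number 0 (convex hull R) \<le> card S"
proof -
  have "{v. v extreme_point_of convex hull R} \<subseteq> S"
    unfolding assms(2)[symmetric] by (rule extreme_points_of_convex_hull)
  then show ?thesis unfolding face_number_0 using assms(1) by (intro card_mono)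
qed

text \<open>
  A dependency in which, after multiplication by the denominators, only the coefficient of \<open>i\<close> is negative shows that
  \<open>Y i = (f i, 1) / \<phi>(f i)\<close> lies in the hull of the other points \<open>Y j\<close>. Working with the points \<open>Y\<close> rather
  than with their images is essential when \<open>A\<close> is singular: the points \<open>Y\<close> are pairwise distinct, so \<open>Y i\<close> is not an extreme
  point, while the images of several of them may coincide in a vertex.
\<close>
lemma vertices_projective_image_le:
  fixes f :: "nat \<Rightarrow> 'a::euclidean_space"
  assumes I: "finite I" "inj_on f I" "Z \<subseteq> I"
    and A: "linear A"
    and phi: "\<And>i. i \<in> I \<Longrightarrow> c \<bullet> f i + \<delta> \<noteq> 0"
    and Z: "\<And>i. i \<in> Z \<Longrightarrow> \<exists>u. (\<forall>j\<in>I-{i}. 0 \<le> u j * (c \<bullet> f j + \<delta>)) \<and> u i * (c \<bullet> f i + \<delta>) < 0 \<and>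
        (\<Sum>j\<in>I. u j *\<^sub>R f j) = 0 \<and> sum u I = 0"
  shows "face_number 0 (convex hull (projective_map A b c \<delta> ` (f ` I))) + card Z \<le> card I"
proof -
  define phi where "phi i = c \<bullet> f i + \<delta>" for i
  define Y :: "nat \<Rightarrow> 'a \<times> real" where "Y i = (f i /\<^sub>R phi i, 1 / phi i)" for i
  define K where "K p = A (fst p) + snd p *\<^sub>R b" for p :: "'a \<times> real"
  have linK: "linear K"
    unfolding K_def using A by (intro linearI) (auto simp: linear_add linear_scale algebra_simps)
  have KY: "projective_map A b c \<delta> (f i) = K (Y i)" for i
    by (simp add: projective_map_def K_def Y_def phi_def linear_scale[OF A] inverse_eq_divide scaleR_right_distrib)
  have phi0: "phi i \<noteq> 0" if "i \<in> I" for i using phi that by (simp add: phi_def)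
  have injY: "inj_on Y I"
  proof (rule inj_onI)
    fix i j assume ij: "i \<in> I" "j \<in> I" "Y i = Y j"
    then have "phi i = phi j" using phi0 by (simp add: Y_def)
    with ij have "f i = f j" using phi0[of i] by (auto simp: Y_def)
    with ij I show "i = j" by (auto dest: inj_onD)
  qed
  have not_ext: "\<not> Y i extreme_point_of convex hull (Y ` I)" if i: "i \<in> Z" for i
  proof -
    have iI: "i \<in> I" using i I by auto
    obtain u where u: "\<And>j. j \<in> I - {i} \<Longrightarrow> 0 \<le> u j * phi j" "u i * phi i < 0"
        "(\<Sum>j\<in>I. u j *\<^sub>R f j) = 0" "sum u I = 0"
      using Z[OF i] unfolding phi_def by blast
    have nz: "u i \<noteq> 0" "phi i \<noteq> 0" using u(2) by auto
    define w where "w j = u j * phi j / - (u i * phi i)" for j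
    have w0: "0 \<le> w j" if "j \<in> I - {i}" for j
      unfolding w_def using u(1)[OF that] u(2) by (intro divide_nonneg_nonneg) auto
    have "(\<Sum>j\<in>I. u j * phi j) = c \<bullet> (\<Sum>j\<in>I. u j *\<^sub>R f j) + \<delta> * sum u I"
      by (simp add: phi_def inner_sum_right sum_distrib_left sum.distrib algebra_simps)
    then have s: "(\<Sum>j\<in>I. u j * phi j) = 0" using u by simp
    then have "(\<Sum>j\<in>I-{i}. u j * phi j) = - (u i * phi i)"
      using I iI by (simp add: sum.remove[of I i])
    then have w1: "sum w (I - {i}) = 1"
      unfolding w_def sum_divide_distrib[symmetric] using nz by simp
    have "(\<Sum>j\<in>I. (u j * phi j) *\<^sub>R Y j) = (\<Sum>j\<in>I. (u j *\<^sub>R f j, u j))"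
      using phi0 by (intro sum.cong) (auto simp: Y_def)
    also have "\<dots> = 0" using u by (simp add: sum_prod zero_prod_def)
    finally have "(\<Sum>j\<in>I-{i}. (u j * phi j) *\<^sub>R Y j) = - (u i * phi i) *\<^sub>R Y i"
      using I iI by (simp add: sum.remove[of I i] eq_neg_iff_add_eq_0 add.commute)
    then have "(1 / - (u i * phi i)) *\<^sub>R (\<Sum>j\<in>I-{i}. (u j * phi j) *\<^sub>R Y j) = Y i"
      using nz by simp
    then have "(\<Sum>j\<in>I-{i}. w j *\<^sub>R Y j) = Y i"
      by (simp add: w_def scaleR_sum_right)
    moreover have "(\<Sum>j\<in>I-{i}. w j *\<^sub>R Y j) \<in> convex hull (Y ` (I - {i}))"
      using I w0 w1 by (intro convex_sum[OF _ convex_convex_hull]) (auto intro: hull_inc)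
    ultimately have "Y i \<in> convex hull (Y ` (I - {i}))" by simp
    moreover have "Y ` I = insert (Y i) (Y ` (I - {i}))" using iI by auto
    ultimately have "convex hull (Y ` I) = convex hull (Y ` (I - {i}))"
      using hull_redundant by metis
    moreover have "Y i \<notin> Y ` (I - {i})" using injY iI by (auto dest: inj_onD)
    ultimately show ?thesis using extreme_point_of_convex_hull by metis
  qed
  have "convex hull (Y ` I) = convex hull (Y ` (I - Z))"
  proof (rule antisym)
    have "{v. v extreme_point_of convex hull (Y ` I)} \<subseteq> Y ` (I - Z)"
      using extreme_points_of_convex_hull[of "Y ` I"] not_ext by blast
    then have "convex hull {v. v extreme_point_of convex hull (Y ` I)} \<subseteq> convex hull (Y ` (I - Z))"
      by (rule hull_mono)
    then show "convex hull (Y ` I) \<subseteq> convex hull (Y ` (I - Z))"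
      using Krein_Milman_Minkowski[of "convex hull (Y ` I)"] I
      by (simp add: finite_imp_compact_convex_hull)
  qed (intro hull_mono image_mono, blast)
  then have "convex hull (K ` Y ` (I - Z)) = convex hull (K ` Y ` I)"
    by (simp add: convex_hull_linear_image[OF linK, symmetric])
  moreover have "projective_map A b c \<delta> ` f ` I = K ` Y ` I"
    using KY by (simp add: image_image)
  ultimately have "face_number 0 (convex hull (projective_map A b c \<delta> ` (f ` I))) \<le> card (K ` Y ` (I - Z))"
    using I by (intro face_number_0_le) auto
  also have "\<dots> \<le> card (I - Z)"
    using I by (simp add: image_image) (rule card_image_le, simp)
  also have "\<dots> = card I - card Z" using I by (intro card_Diff_subset) (auto intro: finite_subset)
  finally show ?thesis using card_mono[OF I(1,3)] by simp
qed

text \<open>The block structure required by \<open>card_facets\<close>: a first block of \<open>L + 4\<close> columns, then blocks of \<open>5 + e\<close>.\<close>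
lemma threshold_index:
  fixes L e p :: nat
  defines "J \<equiv> \<lambda>x. min p (1 + (x + 1 + e - L) div (5 + e))"
  assumes "1 \<le> p"
  shows "1 \<le> J x" "J x \<le> p" "J (Suc x) = J x \<or> J (Suc x) = Suc (J x)"
    and "2 \<le> J x \<Longrightarrow> L + 5 * J x + (J x - 2) * e \<le> x + 6"
    and "J x < p \<Longrightarrow> x + 2 \<le> L + 5 * J x + (J x - 1) * e"
proof -
  define m where "m x = x + 1 + e - L" for x
  define D where "D x = m x div (5 + e)" for x
  have J: "J x = min p (1 + D x)" for x by (simp add: J_def D_def m_def)
  show "1 \<le> J x" "J x \<le> p" using assms(2) by (auto simp: J)
  have "m (Suc x) = m x \<or> m (Suc x) = Suc (m x)" by (auto simp: m_def)
  then have "D (Suc x) = D x \<or> D (Suc x) = Suc (D x)"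
    unfolding D_def by (elim disjE) (simp_all add: div_Suc)
  then show "J (Suc x) = J x \<or> J (Suc x) = Suc (J x)" unfolding J by auto
  show "L + 5 * J x + (J x - 2) * e \<le> x + 6" if j: "2 \<le> J x"
  proof -
    obtain k where k: "J x = k + 2" using le_Suc_ex[OF j] by (metis add.commute)
    have "k + 1 \<le> D x" using k J[of x] by linarith
    then have "(k + 1) * (5 + e) \<le> D x * (5 + e)" by (rule mult_le_mono1)
    also have "\<dots> \<le> m x" unfolding D_def by (rule div_times_less_eq_dividend)
    finally have "(k + 1) * (5 + e) \<le> m x" .
    then have "5 * k + 5 + k * e + e \<le> m x" by (simp add: algebra_simps)
    then show ?thesis unfolding m_def k by (simp add: algebra_simps)
  qed
  show "x + 2 \<le> L + 5 * J x + (J x - 1) * e" if "J x < p"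
  proof -
    have k: "J x = D x + 1" using that J[of x] by linarith
    have "m x < (D x + 1) * (5 + e)"
      unfolding D_def using dividend_less_div_times[of "5 + e" "m x"] by (simp add: algebra_simps)
    then have "m x < 5 * D x + 5 + D x * e + e" by (simp add: algebra_simps)
    then show ?thesis unfolding m_def k by (simp add: algebra_simps)
  qed
qed

lemma unisolvent_zero:
  assumes "unisolvent V C k" "\<forall>m\<in>{1..k}. (\<Sum>i\<in>C. u i * V i m) = 0" "i \<in> C"
  shows "u i = 0"
  using assms unfolding unisolvent_def by (elim conjE) (drule spec[of _ u], blast)

text \<open>
  The first coordinates are positive, so the vectors can be scaled to have first coordinate \<open>1\<close>; the remaining
  \<open>d\<close> coordinates are then those of a point of the given space.
\<close>
lemma points_realizing:
  fixes V :: "nat \<Rightarrow> nat \<Rightarrow> real"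
  assumes V: "realizes a n V" and a1: "\<And>i. a 1 i" and d: "2 \<le> Suc DIM('a::euclidean_space)"
  obtains f :: "nat \<Rightarrow> 'a::euclidean_space"
  where "inj_on f {..<n}" "general_position (f ` {..<n})"
    "\<And>i. i < n \<Longrightarrow> 0 < V i 1"
    "\<And>C u. C \<subseteq> {..<n} \<Longrightarrow> (\<Sum>i\<in>C. u i *\<^sub>R f i) = 0 \<and> sum u C = 0 \<longleftrightarrow>
       (\<forall>m\<in>{1..Suc DIM('a::euclidean_space)}. (\<Sum>i\<in>C. (u i / V i 1) * V i m) = 0)"
proof -
  let ?r = "Suc DIM('a)"
  have pos: "0 < V i 1" if "i < n" for i
  proof -
    have "tilted a V {i} {i} 1 i" using V that chain.start unfolding realizes_def by blast
    then obtain c where "0 < c i" "0 < c i * V i 1"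
      using a1 by (auto simp: tilted_def balanced_def pattern_def sg_def)
    then show ?thesis by (simp add: zero_less_mult_iff)
  qed
  define M where "M = {2..?r}"
  have M: "finite M" "{1..?r} = insert 1 M" by (auto simp: M_def)
  have "card M = card (Basis :: 'a set)" by (simp add: M_def)
  then obtain \<beta> where beta: "bij_betw \<beta> M (Basis :: 'a set)"
    using finite_same_card_bij[of M "Basis :: 'a set"] M by auto
  define f where "f i = (\<Sum>m\<in>M. (V i m / V i 1) *\<^sub>R \<beta> m)" for i
  have comp: "f i \<bullet> \<beta> m = V i m / V i 1" if m: "m \<in> M" for i m
  proof -
    have "f i \<bullet> \<beta> m = (\<Sum>k\<in>M. V i k / V i 1 * (\<beta> k \<bullet> \<beta> m))"
      by (simp add: f_def inner_sum_left)
    also have "\<dots> = (\<Sum>k\<in>M. if k = m then V i k / V i 1 else 0)"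
    proof (intro sum.cong refl)
      fix k assume k: "k \<in> M"
      have "\<beta> k \<in> Basis" "\<beta> m \<in> Basis" using beta k m by (auto dest: bij_betwE)
      moreover have "\<beta> k = \<beta> m \<longleftrightarrow> k = m" using beta k m by (auto simp: bij_betw_def dest: inj_onD)
      ultimately show "V i k / V i 1 * (\<beta> k \<bullet> \<beta> m) = (if k = m then V i k / V i 1 else 0)"
        by (simp add: inner_Basis)
    qed
    finally show ?thesis using m M by simp
  qed
  have key: "(\<Sum>i\<in>C. u i *\<^sub>R f i) = 0 \<and> sum u C = 0 \<longleftrightarrow>
       (\<forall>m\<in>{1..?r}. (\<Sum>i\<in>C. (u i / V i 1) * V i m) = 0)" if C: "C \<subseteq> {..<n}" for C u
  proof -
    have "(\<Sum>i\<in>C. u i *\<^sub>R f i) = 0 \<longleftrightarrow> (\<forall>m\<in>M. (\<Sum>i\<in>C. u i *\<^sub>R f i) \<bullet> \<beta> m = 0)"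
    proof -
      have "(\<Sum>i\<in>C. u i *\<^sub>R f i) = 0 \<longleftrightarrow> (\<forall>b\<in>\<beta> ` M. (\<Sum>i\<in>C. u i *\<^sub>R f i) \<bullet> b = 0)"
        using beta by (simp add: bij_betw_def euclidean_all_zero_iff)
      then show ?thesis by blast
    qed
    also have "\<dots> \<longleftrightarrow> (\<forall>m\<in>M. (\<Sum>i\<in>C. (u i / V i 1) * V i m) = 0)"
      by (intro ball_cong refl) (simp add: inner_sum_left comp)
    finally have 1: "(\<Sum>i\<in>C. u i *\<^sub>R f i) = 0 \<longleftrightarrow> (\<forall>m\<in>M. (\<Sum>i\<in>C. (u i / V i 1) * V i m) = 0)" .
    have "(\<Sum>i\<in>C. (u i / V i 1) * V i 1) = sum u C"
      using pos C by (intro sum.cong refl) force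
    then show ?thesis using 1 unfolding M(2) by auto
  qed
  have indep: "u i = 0" if C: "C \<subseteq> {..<n}" "card C \<le> ?r" "(\<Sum>i\<in>C. u i *\<^sub>R f i) = 0" "sum u C = 0" "i \<in> C" for C u i
  proof -
    have "\<forall>m\<in>{1..card C}. (\<Sum>i\<in>C. (u i / V i 1) * V i m) = 0" using key[OF C(1), of u] C by auto
    moreover have "unisolvent V C (card C)" using V C(1) unfolding realizes_def by blast
    ultimately have "u i / V i 1 = 0" 
      using C(5) unisolvent_zero[of V C "card C" "\<lambda>i. u i / V i 1"] by simp
    then show ?thesis using pos[of i] C by auto
  qed
  have inj: "inj_on f {..<n}"
  proof (rule inj_onI, rule ccontr)
    fix i j assume ij: "i \<in> {..<n}" "j \<in> {..<n}" "f i = f j" "i \<noteq> j"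
    have "(1::real) = 0"
      using indep[of "{i,j}" "\<lambda>k. if k = i then 1 else - 1" i] ij d by simp
    then show False by simp
  qed
  have gp: "general_position (f ` {..<n})"
    unfolding general_position_def
  proof (intro allI impI notI)
    fix S assume S: "S \<subseteq> f ` {..<n} \<and> finite S \<and> card S \<le> DIM('a) + 1" and dep: "affine_dependent S"
    then obtain C where C: "C \<subseteq> {..<n}" "S = f ` C" by (meson subset_imageE)
    have injC: "inj_on f C" using inj C(1) by (rule inj_on_subset)
    obtain U where U: "sum U S = 0" "\<exists>v\<in>S. U v \<noteq> 0" "(\<Sum>v\<in>S. U v *\<^sub>R v) = 0"
      using dep S affine_dependent_explicit_finite by blast
    have "card C \<le> ?r" using S C injC by (simp add: card_image)
    moreover have "(\<Sum>i\<in>C. U (f i) *\<^sub>R f i) = 0" "(\<Sum>i\<in>C. U (f i)) = 0"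
      using U C injC by (simp_all add: sum.reindex)
    ultimately have "\<forall>i\<in>C. U (f i) = 0" using indep[OF C(1), of "\<lambda>i. U (f i)"] by blast
    then show False using U(2) C by auto
  qed
  show thesis by (rule that[OF inj gp pos key])
qed

text \<open>The sign matrix in which row \<open>k\<close> changes its sign after column \<open>x\<close> exactly if \<open>k\<close> exceeds \<open>2 J(x)\<close>.\<close>
definition step_sign :: "(nat \<Rightarrow> nat) \<Rightarrow> nat \<Rightarrow> nat \<Rightarrow> bool" where
  "step_sign J k i \<longleftrightarrow> even (card {x. x < i \<and> \<not> k \<le> 2 * J x})"

lemma step_sign_Suc: "step_sign J k (Suc i) = (step_sign J k i \<longleftrightarrow> k \<le> 2 * J i)"
proof -
  have "{x. x < Suc i \<and> \<not> k \<le> 2 * J x} =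
      (if k \<le> 2 * J i then {x. x < i \<and> \<not> k \<le> 2 * J x} else insert i {x. x < i \<and> \<not> k \<le> 2 * J x})"
    by (auto simp: less_Suc_eq)
  then show ?thesis by (auto simp: step_sign_def)
qed

text \<open>
  The signs of \<open>\<phi>\<close> on the points have no full chain, because the corresponding positive dependency would have a
  positive value under \<open>\<phi>\<close>. If flipping the sign of point \<open>i\<close> creates a full chain, its dependency involves \<open>i\<close> and
  shows that \<open>i\<close> does not contribute a vertex. So the vertices are counted by \<open>card_facets\<close>.
\<close>
theorem ex_few_vertices:
  fixes L e n :: nat
  assumes d: "2 \<le> DIM('a::euclidean_space)" and n: "2 \<le> n" and L: "L \<le> e + 3"
    and size: "L + 2 * DIM('a::euclidean_space) + DIM('a::euclidean_space) div 2 + (DIM('a::euclidean_space) div 2 - 1) * e \<le> n"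
  shows "\<exists>X :: 'a::euclidean_space set. finite X \<and> card X = n \<and> general_position X \<and> proj_h 0 X + L \<le> n"
proof -
  define p where "p = DIM('a) div 2"
  define r where "r = Suc DIM('a)"
  define J where "J x = min p (1 + (x + 1 + e - L) div (5 + e))" for x
  have p: "1 \<le> p" "p = (r - 1) div 2" using d by (auto simp: p_def r_def)
  note J = threshold_index[OF p(1), where L = L and e = e, folded J_def]
  define a where "a = step_sign J"
  obtain N where nN: "n = Suc N" "1 \<le> N" using n by (cases n) auto
  obtain V where V: "realizes a n V" using ex_realizes by blast
  have a1: "a 1 i" for i
  proof (induction i)
    case (Suc i)
    have "1 \<le> 2 * J i" using J(1)[of i] by simp
    then show ?case using Suc by (simp only: a_def step_sign_Suc)
  qed (simp add: a_def step_sign_def)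
  obtain f :: "nat \<Rightarrow> 'a" where f: "inj_on f {..<n}" "general_position (f ` {..<n})"
    "\<And>i. i < n \<Longrightarrow> 0 < V i 1"
    "\<And>C u. C \<subseteq> {..<n} \<Longrightarrow> (\<Sum>i\<in>C. u i *\<^sub>R f i) = 0 \<and> sum u C = 0 \<longleftrightarrow>
       (\<forall>m\<in>{1..Suc DIM('a)}. (\<Sum>i\<in>C. (u i / V i 1) * V i m) = 0)"
    using points_realizing[OF V a1, where 'a = 'a] d by auto
  have dep: "\<exists>C u. C \<subseteq> {..<n} \<and> C \<noteq> {} \<and> (\<forall>i\<in>C. 0 < u i * sg P i) \<and> (\<forall>i. i \<notin> C \<longrightarrow> u i = 0) \<and>
      (\<Sum>i\<in>C. u i *\<^sub>R f i) = 0 \<and> sum u C = 0"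
    if ch: "chain (pattern a P) (Suc r) C e" "e \<le> N" for P C e
  proof -
    have C: "C \<subseteq> {..<n}" "C \<noteq> {}" using chain_subset[OF ch(1)] chain_props[OF ch(1)] ch(2) nN by force+
    obtain c where c: "balanced V P C r c"
      using V ch nN unfolding realizes_def tilted_def by fastforce
    define u where "u i = (if i \<in> C then c i * sg P i * V i 1 else 0)" for i
    have sq: "sg P i * sg P i = 1" for i by (simp add: sg_def)
    have "0 < u i * sg P i" if "i \<in> C" for i
    proof -
      have "u i * sg P i = c i * V i 1 * (sg P i * sg P i)" using that by (simp add: u_def)
      then show ?thesis unfolding sq using that c f(3)[of i] C(1) by (auto simp: balanced_def)
    qed
    moreover have "\<forall>m\<in>{1..Suc DIM('a)}. (\<Sum>i\<in>C. (u i / V i 1) * V i m) = 0"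
    proof
      fix m assume m: "m \<in> {1..Suc DIM('a)}"
      have "(\<Sum>i\<in>C. (u i / V i 1) * V i m) = (\<Sum>i\<in>C. c i * sg P i * V i m)"
        using f(3) C(1) by (intro sum.cong refl) (force simp: u_def)
      then show "(\<Sum>i\<in>C. (u i / V i 1) * V i m) = 0" using c m by (simp add: balanced_def r_def)
    qed
    ultimately show ?thesis using f(4)[OF C(1), of u] C
      by (intro exI[of _ C] exI[of _ u]) (auto simp: u_def)
  qed
  have bound: "face_number 0 (convex hull (projective_map A b c \<delta> ` (f ` {..<n}))) + L \<le> n"
    if A: "linear A" and phi0: "\<And>i. i < n \<Longrightarrow> c \<bullet> f i + \<delta> \<noteq> 0" for A b c \<delta>
  proof -
    define phi where "phi i = c \<bullet> f i + \<delta>" for i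
    define P where "P = {i. i < n \<and> 0 < phi i}"
    have lin: "(\<Sum>i\<in>C. u i * phi i) = c \<bullet> (\<Sum>i\<in>C. u i *\<^sub>R f i) + \<delta> * sum u C" for C u
      by (simp add: phi_def inner_sum_right sum_distrib_left sum.distrib algebra_simps)
    have sgphi: "0 < x * phi i" if "0 < x * sg P i" "i < n" for x i
    proof (cases "0 < phi i")
      case True
      then show ?thesis using that by (simp add: sg_def P_def)
    next
      case False
      then have "phi i < 0" "x < 0" using that phi0[OF that(2)] by (simp_all add: sg_def P_def phi_def)
      then show ?thesis by (rule mult_neg_neg[rotated])
    qed
    have tope: "no_full_chain r N (pattern a P)"
      unfolding no_full_chain_def
    proof (intro allI impI, rule ccontr)
      fix C e assume ch: "chain (pattern a P) (Suc r) C e" and "\<not> N < e"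
      then have "e \<le> N" by simp
      from dep[OF ch this] obtain C u where u: "C \<subseteq> {..<n}" "C \<noteq> {}" "\<forall>i\<in>C. 0 < u i * sg P i"
          "(\<Sum>i\<in>C. u i *\<^sub>R f i) = 0" "sum u C = 0"
        by blast
      have "0 < (\<Sum>i\<in>C. u i * phi i)"
        using u sgphi by (intro sum_pos) (auto intro: finite_subset)
      then show False using lin[of u C] u by simp
    qed
    interpret threshold_tope "pattern a P" N r p J "\<lambda>x. x \<in> P \<longleftrightarrow> Suc x \<in> P"
    proof
      fix x k
      show "pattern a P k x = pattern a P k (Suc x) \<longleftrightarrow> ((x \<in> P \<longleftrightarrow> Suc x \<in> P) \<longleftrightarrow> k \<le> 2 * J x)"
        unfolding pattern_def a_def step_sign_Suc by blast
    qed (use tope nN p J r_def in auto)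
    have "L + 2 * (r - 1) + p + (p - 1) * e \<le> Suc N"
      using size nN by (simp add: r_def p_def)
    then have "card facets + L \<le> Suc N" by (intro card_facets[OF L] J)
    then have many: "card facets + L \<le> n" using nN by simp
    have fac: "facets \<subseteq> {..<n}" by (auto simp: facets_def nN)
    define Z where "Z = {..<n} - facets"
    have Zdep: "\<exists>u. (\<forall>j\<in>{..<n}-{i}. 0 \<le> u j * (c \<bullet> f j + \<delta>)) \<and> u i * (c \<bullet> f i + \<delta>) < 0 \<and>
        (\<Sum>j\<in>{..<n}. u j *\<^sub>R f j) = 0 \<and> sum u {..<n} = 0" if i: "i \<in> Z" for i
    proof -
      define P' where "P' = (if i \<in> P then P - {i} else insert i P)"
      have "flip i (pattern a P) = pattern a P'"
        by (intro ext) (auto simp: flip_def pattern_def P'_def)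
      then have "\<not> no_full_chain r N (pattern a P')" using i nN by (auto simp: Z_def facets_def)
      then obtain C0 e where C0: "chain (pattern a P') (Suc r) C0 e" "e \<le> N"
        unfolding no_full_chain_def by (auto simp: not_less)
      from dep[OF C0] obtain C u where u: "C \<subseteq> {..<n}" "C \<noteq> {}" "\<And>i. i \<in> C \<Longrightarrow> 0 < u i * sg P' i"
          "\<And>i. i \<notin> C \<Longrightarrow> u i = 0" "(\<Sum>i\<in>C. u i *\<^sub>R f i) = 0" "sum u C = 0"
        by blast
      have finC: "finite C" using u(1) by (rule finite_subset) simp
      have sg': "sg P' j = sg P j" if "j \<noteq> i" for j using that by (simp add: sg_def P'_def)
      have sgi: "sg P' i = - sg P i" by (simp add: sg_def P'_def)
      have others: "0 < u j * phi j" if "j \<in> C" "j \<noteq> i" for j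
        using sgphi[of "u j" j] u(1,3) that sg' by (metis lessThan_iff subsetD)
      have zero: "(\<Sum>j\<in>C. u j * phi j) = 0" using lin[of u C] u by simp
      have iC: "i \<in> C"
      proof (rule ccontr)
        assume "i \<notin> C"
        then have "0 < (\<Sum>j\<in>C. u j * phi j)" using finC u(2) others by (intro sum_pos) auto
        then show False using zero by simp
      qed
      have "0 < (- u i) * sg P i" using u(3)[OF iC] sgi by simp
      then have "0 < (- u i) * phi i" using sgphi u(1) iC by blast
      then have "u i * phi i < 0" by simp
      moreover have "0 \<le> u j * phi j" if "j \<noteq> i" for j
        using others[of j] u(4)[of j] that by (cases "j \<in> C") auto
      moreover have "(\<Sum>j\<in>{..<n}. u j *\<^sub>R f j) = (\<Sum>i\<in>C. u i *\<^sub>R f i)"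
        using u(1,4) by (intro sum.mono_neutral_right) auto
      moreover have "sum u {..<n} = sum u C"
        using u(1,4) by (intro sum.mono_neutral_right) auto
      ultimately show ?thesis using u(5,6) unfolding phi_def by (intro exI[of _ u]) auto
    qed
    have "face_number 0 (convex hull (projective_map A b c \<delta> ` (f ` {..<n}))) + card Z \<le> card {..<n}"
      by (rule vertices_projective_image_le[OF _ f(1) _ A _ Zdep]) (use phi0 Z_def in auto)
    moreover have "card Z = n - card facets"
      unfolding Z_def using fac by (subst card_Diff_subset) (auto intro: finite_subset)
    moreover have "card facets \<le> n" using card_mono[OF _ fac] by simp
    ultimately show ?thesis using many by simp
  qed
  define X where "X = f ` {..<n}"
  have X: "finite X" "card X = n" using f(1) by (auto simp: X_def card_image)
  let ?vals = "(\<lambda>(A, b, c, \<delta>). face_number 0 (convex hull (projective_map A b c \<delta> ` X))) ` permissible_parameters X"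
  have "Max ?vals \<in> ?vals" using proj_h_range(1,2)[OF X(1)] by (rule Max_in)
  then obtain A b c \<delta> where "(A, b, c, \<delta>) \<in> permissible_parameters X"
      "proj_h 0 X = face_number 0 (convex hull (projective_map A b c \<delta> ` X))"
    unfolding proj_h_def by auto
  then have "proj_h 0 X + L \<le> n"
    using bound[of A c \<delta> b] by (auto simp: permissible_parameters_def X_def)
  then show ?thesis using X f(2) unfolding X_def by blast
qed

section \<open>Complete cells of small arrangements\<close>

text \<open>Finitely many proper affine subspaces do not cover the space.\<close>
lemma general_position_extend:
  fixes X :: "'a::euclidean_space set"
  assumes "finite X" "general_position X"
  shows "\<exists>x. x \<notin> X \<and> general_position (insert x X)"
proof -
  let ?F = "{S. S \<subseteq> X \<and> card S \<le> DIM('a)}"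
  have "negligible (affine hull S)" if "S \<in> ?F" for S
  proof -
    have "finite S" using that assms(1) by (auto intro: finite_subset)
    then have "aff_dim S \<le> int (card S) - 1" by (rule aff_dim_le_card)
    then have "aff_dim (affine hull S) < DIM('a)" using that by simp
    then obtain a b where "a \<noteq> 0" "affine hull S \<subseteq> {x. a \<bullet> x = b}"
      using aff_lowdim_subset_hyperplane by blast
    then show ?thesis using negligible_hyperplane[of a b] negligible_subset by blast
  qed
  then have "negligible (\<Union>S\<in>?F. affine hull S)"
    using assms(1) by (intro negligible_Union) auto
  then have "(\<Union>S\<in>?F. affine hull S) \<noteq> UNIV" using non_negligible_UNIV by metis
  then obtain x where x: "\<And>S. S \<in> ?F \<Longrightarrow> x \<notin> affine hull S" by blast
  have "x \<notin> X"
  proof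
    assume "x \<in> X"
    then have "{x} \<in> ?F" by (auto simp: Suc_leI)
    with x show False by force
  qed
  moreover have "\<not> affine_dependent S"
    if S: "S \<subseteq> insert x X" "finite S" "card S \<le> DIM('a) + 1" for S
  proof (cases "x \<in> S")
    case True
    then have "S - {x} \<in> ?F" using S by (auto simp: card_Diff_singleton)
    moreover have "\<not> affine_dependent (S - {x})"
      using assms(2) \<open>S - {x} \<in> ?F\<close> S(2) unfolding general_position_def by simp
    ultimately have "\<not> affine_dependent (insert x (S - {x}))"
      using x by (intro affine_independent_insert) auto
    then show ?thesis using True by (simp add: insert_absorb)
  next
    case False
    then show ?thesis using assms(2) S unfolding general_position_def by auto
  qed
  ultimately show ?thesis unfolding general_position_def by blast
qed

lemma general_position_extend_card:
  fixes X :: "'a::euclidean_space set"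
  assumes "finite X" "general_position X" "card X \<le> n"
  shows "\<exists>Y. X \<subseteq> Y \<and> finite Y \<and> card Y = n \<and> general_position Y"
  using assms(3)
proof (induction n rule: dec_induct)
  case base
  show ?case using assms by blast
next
  case (step n)
  then obtain Y where Y: "X \<subseteq> Y" "finite Y" "card Y = n" "general_position Y" by blast
  then obtain y where "y \<notin> Y" "general_position (insert y Y)"
    using general_position_extend by blast
  then show ?case using Y by (intro exI[of _ "insert y Y"]) auto
qed

text \<open>
  The vectors in \<open>W\<close> are normals of hyperplanes through the origin, and \<open>\<phi>\<close> represents the cell that contains
  it. The witness \<open>u\<close> is a point in the relative interior of the facet on the hyperplane of \<open>w\<close>.
\<close>
definition wall :: "'b::euclidean_space set \<Rightarrow> 'b \<Rightarrow> 'b \<Rightarrow> bool" where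
  "wall W \<phi> w \<longleftrightarrow> (\<exists>u. u \<bullet> w = 0 \<and> (\<forall>v\<in>W-{w}. 0 < (u \<bullet> v) * (\<phi> \<bullet> v)))"

definition uniform :: "'b::euclidean_space set \<Rightarrow> bool" where
  "uniform W \<longleftrightarrow> finite W \<and> (\<forall>S. S \<subseteq> W \<longrightarrow> card S \<le> DIM('b) \<longrightarrow> independent S)"

lemma prescribed_inner:
  fixes B :: "'b::euclidean_space set"
  assumes "independent B"
  shows "\<exists>t. \<forall>b\<in>B. b \<bullet> t = y b"
proof -
  obtain g :: "'b \<Rightarrow> real" where g: "linear g" "\<forall>b\<in>B. g b = y b"
    using linear_independent_extend[OF assms, of y] by blast
  then have "b \<bullet> adjoint g 1 = g b" for b using adjoint_works[OF g(1), of b 1] by simp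
  with g(2) show ?thesis by (intro exI[of _ "adjoint g 1"]) simp
qed

lemma orthogonal_to_basis:
  fixes B :: "'b::euclidean_space set"
  assumes "independent B" "card B = DIM('b)" "\<And>b. b \<in> B \<Longrightarrow> b \<bullet> z = 0"
  shows "z = 0"
proof -
  have "span B = UNIV"
    using assms(1,2) card_eq_dim[of B UNIV] independent_imp_finite by auto
  have "y \<bullet> z = 0" if "y \<in> span B" for y
    using that
  proof (induction rule: span_induct)
    case (step b)
    then show ?case using assms(3) by simp
  qed (auto intro!: subspaceI simp: inner_add_left)
  then have "z \<bullet> z = 0" using \<open>span B = UNIV\<close> by simp
  then show ?thesis by simp
qed

lemma uniformD: "uniform W \<Longrightarrow> S \<subseteq> W \<Longrightarrow> card S \<le> DIM('b) \<Longrightarrow> independent (S :: 'b::euclidean_space set)"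
  by (simp add: uniform_def)

text \<open>
  The cell is the cone over the points \<open>P g\<close>, its walls are the elements of \<open>D\<close>, and all other hyperplanes miss it.
  To find it, use \<open>v1 = 1\<close> as affine chart and choose a vertex of the arrangement, off the hyperplane of \<open>v0\<close>, whose \<open>v0\<close>-coordinate
  is as small as possible in absolute value. The edges from this vertex to the hyperplane of \<open>v0\<close> span the
  simplex: a hyperplane that crosses it would cross one of these edges, in a vertex with a smaller
  \<open>v0\<close>-coordinate.
\<close>
lemma simplicial_cell:
  fixes W :: "'b::euclidean_space set"
  assumes W: "uniform W" and card: "DIM('b) + 1 \<le> card W" and d: "2 \<le> DIM('b)"
  shows "\<exists>D P s. D \<subseteq> W \<and> card D = DIM('b) \<and> (\<forall>g\<in>D. g \<bullet> P g \<noteq> 0) \<and>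
    (\<forall>g\<in>D. \<forall>h\<in>D. h \<noteq> g \<longrightarrow> h \<bullet> P g = 0) \<and>
    (\<forall>f\<in>W-D. \<forall>g\<in>D. 0 < s f * (f \<bullet> (P g :: 'b)))"
proof -
  let ?d = "DIM('b)"
  have fin: "finite W" using W by (simp add: uniform_def)
  obtain v0 where v0: "v0 \<in> W" using card by fastforce
  have "card (W - {v0}) \<noteq> 0" using v0 fin card d by (simp add: card_Diff_singleton)
  then have "W - {v0} \<noteq> {}" by force
  then obtain v1 where v1: "v1 \<in> W" "v1 \<noteq> v0" by blast
  define R where "R = W - {v0, v1}"
  define F where "F = {S. S \<subseteq> R \<and> card S = ?d - 1}"
  have "card R = card W - 2" using v0 v1 fin by (simp add: R_def card_Diff_subset)
  then have cR: "?d - 1 \<le> card R" using card by simp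
  have finR: "finite R" using fin by (simp add: R_def)
  have "finite F" using finR by (simp add: F_def)
  moreover have "F \<noteq> {}" using obtain_subset_with_card_n[OF cR] unfolding F_def by blast
  define pt where "pt S = (SOME z. (\<forall>h\<in>S. h \<bullet> z = 0) \<and> v1 \<bullet> z = 1)" for S
  have full: "z = 0" if "S \<subseteq> W" "card S = ?d" "\<And>b. b \<in> S \<Longrightarrow> b \<bullet> z = 0" for S and z :: 'b
    using orthogonal_to_basis[of S z] uniformD[OF W, of S] that by simp
  have cI: "card (insert x S) = ?d" if "card S = ?d - 1" "x \<notin> S" "S \<subseteq> W" for x S
    using that fin d by (simp add: card_insert_disjoint finite_subset)
  have pt: "(\<forall>h\<in>S. h \<bullet> pt S = 0) \<and> v1 \<bullet> pt S = 1"
    if S: "S \<subseteq> W" "card S = ?d - 1" "v1 \<notin> S" for S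
  proof -
    have "independent (insert v1 S)" using uniformD[OF W, of "insert v1 S"] cI[of S v1] S v1 by auto
    then obtain z where "\<forall>b\<in>insert v1 S. b \<bullet> z = (if b = v1 then 1 else 0)"
      using prescribed_inner[of _ "\<lambda>b. if b = v1 then 1 else 0"] by blast
    then have "\<exists>z. (\<forall>h\<in>S. h \<bullet> z = 0) \<and> v1 \<bullet> z = 1" using S(3) by (intro exI[of _ z]) auto
    then show ?thesis unfolding pt_def by (rule someI_ex)
  qed
  have uniq: "z = pt S" if S: "S \<subseteq> W" "card S = ?d - 1" "v1 \<notin> S" and z: "\<And>h. h \<in> S \<Longrightarrow> h \<bullet> z = 0" "v1 \<bullet> z = 1" for S z
  proof -
    have "z - pt S = 0"
      using pt[OF S] z v1 S cI[of S v1] by (intro full[of "insert v1 S"]) (auto simp: inner_diff_right)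
    then show ?thesis by simp
  qed
  obtain S where S: "S \<in> F" and min: "\<And>S'. S' \<in> F \<Longrightarrow> \<bar>v0 \<bullet> pt S\<bar> \<le> \<bar>v0 \<bullet> pt S'\<bar>"
    using ex_min_if_finite[of "(\<lambda>S. \<bar>v0 \<bullet> pt S\<bar>) ` F"] \<open>finite F\<close> \<open>F \<noteq> {}\<close>
    by (auto simp: not_less)
  have SW: "S \<subseteq> W" "card S = ?d - 1" "v1 \<notin> S" "v0 \<notin> S" using S by (auto simp: F_def R_def)
  have finS: "finite S" using SW(1) fin by (rule finite_subset)
  define D where "D = insert v0 S"
  define N where "N g = insert v0 (S - {g})" for g
  have N: "N g \<subseteq> W" "card (N g) = ?d - 1" "v1 \<notin> N g" if "g \<in> S" for g
    using that SW v0 v1 finS d by (auto simp: N_def card_Diff_singleton)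
  define P where "P g = (if g = v0 then pt S else pt (N g))" for g
  have D: "D \<subseteq> W" "card D = ?d" using SW v0 cI[of S v0] by (auto simp: D_def)
  have nz: "pt S' \<noteq> 0" if "S' \<subseteq> W" "card S' = ?d - 1" "v1 \<notin> S'" for S'
    using pt[OF that] by auto
  have v0z: "v0 \<bullet> pt S \<noteq> 0"
    using full[of D "pt S"] D pt[OF SW(1-3)] nz[OF SW(1-3)] by (auto simp: D_def)
  have gP: "g \<bullet> P g \<noteq> 0" if g: "g \<in> D" for g
  proof (cases "g = v0")
    case False
    then have gS: "g \<in> S" using g by (simp add: D_def)
    have "insert g (N g) = D" using gS by (auto simp: N_def D_def)
    then show ?thesis
      using full[of D "pt (N g)"] D pt[OF N[OF gS]] nz[OF N[OF gS]] False by (auto simp: P_def)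
  qed (simp add: P_def v0z)
  have hP: "h \<bullet> P g = 0" if "g \<in> D" "h \<in> D" "h \<noteq> g" for g h
  proof (cases "g = v0")
    case True
    then show ?thesis using that pt[OF SW(1-3)] by (auto simp: P_def D_def)
  next
    case False
    then have gS: "g \<in> S" using that by (simp add: D_def)
    then show ?thesis using that pt[OF N[OF gS]] False by (auto simp: P_def D_def N_def)
  qed
  have same: "0 < (f \<bullet> pt S) * (f \<bullet> P g)" if f: "f \<in> W - D" and g: "g \<in> D" for f g
  proof -
    have fz: "f \<bullet> pt S \<noteq> 0"
      using full[of "insert f S" "pt S"] cI[of S f] f SW pt[OF SW(1-3)] nz[OF SW(1-3)] by (auto simp: D_def)
    show ?thesis
    proof (cases "g = v0")
      case True
      then show ?thesis using fz by (simp add: P_def zero_less_mult_iff) argo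
    next
      case False
      then have gS: "g \<in> S" using g by (simp add: D_def)
      let ?z = "pt S" and ?y = "pt (N g)"
      note ptS = pt[OF SW(1-3)] and ptN = pt[OF N[OF gS]]
      show ?thesis
      proof (cases "f = v1")
        case True
        then show ?thesis using ptS ptN False by (simp add: P_def)
      next
        case fv1: False
        have fy: "f \<bullet> ?y \<noteq> 0"
          using full[of "insert f (N g)" ?y] cI[of "N g" f] f N[OF gS] ptN nz[OF N[OF gS]]
          by (auto simp: D_def N_def)
        have "\<not> (f \<bullet> ?z) * (f \<bullet> ?y) < 0"
        proof
          assume neg: "(f \<bullet> ?z) * (f \<bullet> ?y) < 0"
          define l where "l = (f \<bullet> ?z) / (f \<bullet> ?z - f \<bullet> ?y)"
          have l: "0 < l" "l < 1"
            using neg by (auto simp: l_def mult_less_0_iff divide_simps)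
          define z' where "z' = (1 - l) *\<^sub>R ?z + l *\<^sub>R ?y"
          define S' where "S' = insert f (S - {g})"
          have S': "S' \<in> F" "S' \<subseteq> W" "card S' = ?d - 1" "v1 \<notin> S'"
            using f fv1 gS SW S finS d by (auto simp: S'_def F_def R_def D_def card_Diff_singleton)
          have "f \<bullet> z' = 0"
            using neg by (simp add: z'_def l_def inner_add_right divide_simps mult_less_0_iff) (auto simp: algebra_simps)
          then have "h \<bullet> z' = 0" if "h \<in> S'" for h
            using that ptS ptN by (auto simp: S'_def z'_def N_def inner_add_right)
          moreover have "v1 \<bullet> z' = 1" using ptS ptN by (simp add: z'_def inner_add_right)
          ultimately have "z' = pt S'" by (intro uniq S'(2-4))
          then have "\<bar>v0 \<bullet> ?z\<bar> \<le> \<bar>v0 \<bullet> z'\<bar>" using min[OF S'(1)] by simp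
          also have "v0 \<bullet> z' = (1 - l) * (v0 \<bullet> ?z)"
            using ptN by (simp add: z'_def inner_add_right N_def)
          finally have "\<bar>v0 \<bullet> ?z\<bar> \<le> (1 - l) * \<bar>v0 \<bullet> ?z\<bar>" using l by (simp add: abs_mult)
          then show False using v0z l by (simp add: algebra_simps mult_le_0_iff)
        qed
        then show ?thesis using fz fy False by (simp add: P_def not_less less_le)
      qed
    qed
  qed
  show ?thesis
    by (intro exI[of _ D] exI[of _ P] exI[of _ "\<lambda>f. f \<bullet> pt S"] conjI ballI impI D gP hP same)
qed

lemma eventually_pos_perturb:
  fixes a b :: real
  assumes "0 < a"
  shows "\<forall>\<^sub>F \<eta> in at_right 0. 0 < a + \<eta> * b"
proof -
  have "((\<lambda>\<eta>. a + \<eta> * b) \<longlongrightarrow> a + 0 * b) (at_right 0)"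
    by (intro tendsto_intros)
  then show ?thesis using assms order_tendstoD(1)[of _ a] by simp
qed

text \<open>
  Larman's bound for McMullen's problem, in arrangement form. With \<open>D\<close> and \<open>P\<close> from \<open>simplicial_cell\<close>, the
  \<open>DIM - 1\<close> remaining hyperplanes \<open>R\<close> meet in a line, spanned by \<open>x\<close>. Replacing \<open>x\<close> by \<open>- x\<close> if necessary, \<open>x\<close> is on the
  positive side of at least two elements of \<open>D\<close>; this uses \<open>card D \<ge> 3\<close>. The cell wanted contains
  \<open>\<phi> = x + P g0\<close> for one such element \<open>g0\<close>. It touches every hyperplane of \<open>R\<close> near \<open>x\<close>. It touches an element \<open>w\<close> of \<open>D\<close>
  far away in direction \<open>P g2\<close>, for an element \<open>g2\<close> other than \<open>w\<close> of which \<open>x\<close> is on the positive side.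
\<close>
theorem complete_cell:
  fixes W :: "'b::euclidean_space set"
  assumes W: "uniform W" and card: "card W = 2 * DIM('b) - 1" and d: "3 \<le> DIM('b)"
  shows "\<exists>\<phi>. (\<forall>w\<in>W. \<phi> \<bullet> w \<noteq> 0) \<and> (\<forall>w\<in>W. wall W \<phi> w)"
proof -
  have big: "DIM('b) + 1 \<le> card W" "2 \<le> DIM('b)" using card d by auto
  obtain D P s where D: "D \<subseteq> W" "card D = DIM('b)"
    and gP': "\<forall>g\<in>D. g \<bullet> P g \<noteq> 0" and hP': "\<forall>g\<in>D. \<forall>h\<in>D. h \<noteq> g \<longrightarrow> h \<bullet> P g = 0"
    and fP': "\<forall>f\<in>W-D. \<forall>g\<in>D. 0 < s f * (f \<bullet> (P g :: 'b))"
    using simplicial_cell[OF W big] by (elim exE conjE) (rule that)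
  have gP: "g \<bullet> P g \<noteq> 0" if "g \<in> D" for g using gP' that by blast
  have hP: "h \<bullet> P g = 0" if "g \<in> D" "h \<in> D" "h \<noteq> g" for g h using hP' that by blast
  have fP: "0 < s f * (f \<bullet> P g)" if "f \<in> W - D" "g \<in> D" for f g using fP' that by blast
  have fin: "finite W" using W by (simp add: uniform_def)
  then have finD: "finite D" using D by (auto intro: finite_subset)
  define R where "R = W - D"
  have cR: "card R = DIM('b) - 1" using D card fin finD by (simp add: R_def card_Diff_subset)
  have finR: "finite R" using fin by (simp add: R_def)
  have insR: "insert g R \<subseteq> W \<and> card (insert g R) = DIM('b)" if "g \<in> D" for g
    using that D cR finR d by (auto simp: R_def)
  obtain d0 where d0: "d0 \<in> D" using D d by fastforce
  have "independent (insert d0 R)" using uniformD[OF W] insR[OF d0] by simp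
  then obtain y where y: "\<forall>b\<in>insert d0 R. b \<bullet> y = (if b = d0 then 1 else 0)"
    using prescribed_inner[of _ "\<lambda>b. if b = d0 then 1 else 0"] by blast
  have yR: "f \<bullet> y = 0" if "f \<in> R" for f using y that d0 by (auto simp: R_def)
  have y0: "y \<noteq> 0" using y by auto
  have yD: "g \<bullet> y \<noteq> 0" if g: "g \<in> D" for g
    using orthogonal_to_basis[of "insert g R" y] uniformD[OF W] insR[OF g] yR y0 by auto
  define plus where "plus z = {g \<in> D. 0 < (g \<bullet> z) * (g \<bullet> P g)}" for z
  have "plus y \<union> plus (- y) = D"
    using yD gP by (force simp: plus_def zero_less_mult_iff mult_less_0_iff)
  then have "card D \<le> card (plus y) + card (plus (- y))" by (metis card_Un_le)
  then have "2 \<le> card (plus y) \<or> 2 \<le> card (plus (- y))" using D d by linarith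
  then obtain x where x: "x = y \<or> x = - y" "2 \<le> card (plus x)" by blast
  have xR: "f \<bullet> x = 0" if "f \<in> R" for f using x(1) yR[OF that] by auto
  have xD: "g \<bullet> x \<noteq> 0" if "g \<in> D" for g using x(1) yD[OF that] by auto
  obtain T where "T \<subseteq> plus x" "card T = 2" using obtain_subset_with_card_n[OF x(2)] by blast
  then obtain g0 g1 where g01: "g0 \<noteq> g1" "g0 \<in> plus x" "g1 \<in> plus x"
    by (auto simp: card_2_iff)
  then have g0: "g0 \<in> D" "0 < (g0 \<bullet> x) * (g0 \<bullet> P g0)" by (auto simp: plus_def)
  define \<phi> where "\<phi> = x + P g0"
  have phiR: "0 < s f * (f \<bullet> \<phi>)" if "f \<in> R" for f
    using xR[OF that] fP[of f g0] that g0 by (simp add: \<phi>_def R_def inner_add_right)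
  have phiD: "0 < (g \<bullet> \<phi>) * (g \<bullet> x)" if "g \<in> D" for g
  proof (cases "g = g0")
    case True
    have "0 < (g0 \<bullet> x) * (g0 \<bullet> x)" using xD[OF g0(1)] by (simp add: zero_less_mult_iff) argo
    then show ?thesis using True g0(2) by (simp add: \<phi>_def inner_add_right algebra_simps)
  next
    case False
    then show ?thesis using hP[OF g0(1) that] xD[OF that]
      by (simp add: \<phi>_def inner_add_right zero_less_mult_iff) argo
  qed
  have agree: "0 < a * b" if "0 < c * a" "0 < c * b" for a b c :: real
    using that by (auto simp: zero_less_mult_iff)
  have nz: "\<phi> \<bullet> w \<noteq> 0" if "w \<in> W" for w
    using phiR[of w] phiD[of w] that by (cases "w \<in> D") (auto simp: R_def inner_commute)
  have "wall W \<phi> w" if w: "w \<in> W" for w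
  proof (cases "w \<in> D")
    case False
    then have wR: "w \<in> R" using w by (simp add: R_def)
    have "independent R"
      using uniformD[OF W, of R] cR by (auto simp: R_def)
    then obtain t where t: "\<forall>b\<in>R. b \<bullet> t = (if b = w then 0 else s b)"
      using prescribed_inner[of R "\<lambda>b. if b = w then 0 else s b"] by blast
    have "\<forall>\<^sub>F \<eta> in at_right 0. \<forall>g\<in>D. 0 < (g \<bullet> x) * (g \<bullet> \<phi>) + \<eta> * ((g \<bullet> t) * (g \<bullet> \<phi>))"
      using finD phiD by (intro eventually_ball_finite ballI eventually_pos_perturb) (simp_all add: mult.commute)
    then have "\<forall>\<^sub>F \<eta> in at_right 0. 0 < \<eta> \<and> (\<forall>g\<in>D. 0 < (g \<bullet> x) * (g \<bullet> \<phi>) + \<eta> * ((g \<bullet> t) * (g \<bullet> \<phi>)))"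
      using eventually_at_right_less[of "0::real"] by eventually_elim simp
    then obtain \<eta> where eta: "0 < \<eta>" "\<And>g. g \<in> D \<Longrightarrow> 0 < (g \<bullet> x) * (g \<bullet> \<phi>) + \<eta> * ((g \<bullet> t) * (g \<bullet> \<phi>))"
      using eventually_happens'[OF trivial_limit_at_right_real] by blast
    define u where "u = x + \<eta> *\<^sub>R t"
    have "w \<bullet> t = 0" using t wR by simp
    then have "u \<bullet> w = 0" using xR[OF wR] by (simp add: u_def inner_add_right inner_commute[of _ w])
    moreover have "0 < (u \<bullet> v) * (\<phi> \<bullet> v)" if v: "v \<in> W - {w}" for v
    proof (cases "v \<in> D")
      case True
      then show ?thesis using eta(2)[OF True]
        by (simp add: u_def inner_add_left inner_commute algebra_simps)
    next
      case False
      then have vR: "v \<in> R" using v by (simp add: R_def)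
      have "v \<bullet> t = s v" using t vR v by simp
      then have "u \<bullet> v = \<eta> * s v"
        using xR[OF vR] by (simp add: u_def inner_add_right inner_commute[of _ v])
      then show ?thesis using phiR[OF vR] eta(1) by (simp add: inner_commute mult.assoc)
    qed
    ultimately show ?thesis unfolding wall_def by blast
  next
    case True
    obtain g2 where g2: "g2 \<in> plus x" "g2 \<noteq> w" using g01 by metis
    then have g2': "g2 \<in> D" "0 < (g2 \<bullet> x) * (g2 \<bullet> P g2)" by (auto simp: plus_def)
    define c where "c = (w \<bullet> x) / (w \<bullet> P w)"
    have "\<forall>\<^sub>F M in at_top. \<forall>f\<in>R. c * (s f * (f \<bullet> P w)) < s f * (f \<bullet> P g2) * M"
    proof (intro eventually_ball_finite ballI finR)
      fix f assume f: "f \<in> R"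
      have "0 < s f * (f \<bullet> P g2)" using fP f g2' by (simp add: R_def)
      then have "filterlim (\<lambda>M. s f * (f \<bullet> P g2) * M) at_top at_top"
        by (intro filterlim_tendsto_pos_mult_at_top[OF tendsto_const _ filterlim_ident])
      then show "\<forall>\<^sub>F M in at_top. c * (s f * (f \<bullet> P w)) < s f * (f \<bullet> P g2) * M"
        by (rule filterlim_at_top_dense[THEN iffD1, rule_format])
    qed
    then have "\<forall>\<^sub>F M in at_top. 0 < M \<and> (\<forall>f\<in>R. c * (s f * (f \<bullet> P w)) < s f * (f \<bullet> P g2) * M)"
      using eventually_gt_at_top[of "0::real"] by eventually_elim simp
    then obtain M where M: "0 < M" "\<And>f. f \<in> R \<Longrightarrow> c * (s f * (f \<bullet> P w)) < s f * (f \<bullet> P g2) * M"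
      using eventually_happens'[OF trivial_limit_at_top_linorder] by blast
    define u where "u = x - c *\<^sub>R P w + M *\<^sub>R P g2"
    have vu: "v \<bullet> u = v \<bullet> x - c * (v \<bullet> P w) + M * (v \<bullet> P g2)" for v
      by (simp add: u_def inner_add_right inner_diff_right)
    have "u \<bullet> w = 0"
      using vu[of w] hP[OF g2'(1) True] g2 gP[OF True] by (simp add: c_def inner_commute)
    moreover have "0 < (u \<bullet> v) * (\<phi> \<bullet> v)" if v: "v \<in> W - {w}" for v
    proof (cases "v \<in> D")
      case vD: True
      have "v \<bullet> P w = 0" using hP[OF True vD] v by simp
      have "0 < (v \<bullet> x) * (v \<bullet> u)"
      proof (cases "v = g2")
        case True
        have "0 < (v \<bullet> x) * (v \<bullet> x)" using xD[OF vD] by (simp add: zero_less_mult_iff) argo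
        moreover have "0 < M * ((v \<bullet> x) * (v \<bullet> P g2))" using True g2' M by simp
        ultimately show ?thesis using \<open>v \<bullet> P w = 0\<close> by (simp add: vu algebra_simps)
      next
        case False
        then show ?thesis
          using \<open>v \<bullet> P w = 0\<close> hP[OF g2'(1) vD] xD[OF vD] by (simp add: vu zero_less_mult_iff) argo
      qed
      moreover have "0 < (v \<bullet> x) * (v \<bullet> \<phi>)" using phiD[OF vD] by (simp add: mult.commute)
      ultimately have "0 < (v \<bullet> u) * (v \<bullet> \<phi>)" by (rule agree)
      then show ?thesis by (simp only: inner_commute)
    next
      case False
      then have vR: "v \<in> R" using v by (simp add: R_def)
      have "0 < s v * (v \<bullet> u)" using M(2)[OF vR] xR[OF vR] by (simp add: vu algebra_simps)
      then have "0 < (v \<bullet> u) * (v \<bullet> \<phi>)" by (rule agree[OF _ phiR[OF vR]])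
      then show ?thesis by (simp only: inner_commute)
    qed
    ultimately show ?thesis unfolding wall_def by blast
  qed
  with nz show ?thesis by blast
qed

lemma wall_subset: "V \<subseteq> W \<Longrightarrow> wall W \<phi> w \<Longrightarrow> wall V \<phi> w"
  unfolding wall_def by blast

text \<open>A point of a facet can be moved within the facet off a further hyperplane.\<close>
lemma wall_generic:
  fixes f k :: "'b::euclidean_space"
  assumes "finite W" "wall W \<phi> k" "independent {f, k}" "f \<noteq> k"
  obtains u where "u \<bullet> k = 0" "\<And>v. v \<in> W - {k} \<Longrightarrow> 0 < (u \<bullet> v) * (\<phi> \<bullet> v)" "u \<bullet> f \<noteq> 0"
proof -
  obtain u where u: "u \<bullet> k = 0" "\<And>v. v \<in> W - {k} \<Longrightarrow> 0 < (u \<bullet> v) * (\<phi> \<bullet> v)"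
    using assms(2) unfolding wall_def by blast
  show thesis
  proof (cases "u \<bullet> f = 0")
    case False
    then show ?thesis using u that by blast
  next
    case True
    obtain t where t: "\<forall>b\<in>{f, k}. b \<bullet> t = (if b = f then 1 else 0)"
      using prescribed_inner[OF assms(3), of "\<lambda>b. if b = f then 1 else 0"] by blast
    have tk: "t \<bullet> f = 1" "t \<bullet> k = 0" using t assms(4) by (auto simp: inner_commute)
    have "\<forall>\<^sub>F \<eta> in at_right 0. \<forall>v\<in>W-{k}. 0 < (u \<bullet> v) * (\<phi> \<bullet> v) + \<eta> * ((t \<bullet> v) * (\<phi> \<bullet> v))"
      using assms(1) u by (intro eventually_ball_finite ballI eventually_pos_perturb) simp_all
    then have "\<forall>\<^sub>F \<eta> in at_right 0. 0 < \<eta> \<and> (\<forall>v\<in>W-{k}. 0 < (u \<bullet> v) * (\<phi> \<bullet> v) + \<eta> * ((t \<bullet> v) * (\<phi> \<bullet> v)))"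
      using eventually_at_right_less[of "0::real"] by eventually_elim simp
    then obtain \<eta> where eta: "0 < \<eta>"
        "\<And>v. v \<in> W - {k} \<Longrightarrow> 0 < (u \<bullet> v) * (\<phi> \<bullet> v) + \<eta> * ((t \<bullet> v) * (\<phi> \<bullet> v))"
      using eventually_happens'[OF trivial_limit_at_right_real] by blast
    show ?thesis
    proof (rule that[of "u + \<eta> *\<^sub>R t"])
      show "(u + \<eta> *\<^sub>R t) \<bullet> k = 0" using u tk by (simp add: inner_add_left)
      show "0 < ((u + \<eta> *\<^sub>R t) \<bullet> v) * (\<phi> \<bullet> v)" if "v \<in> W - {k}" for v
        using eta(2)[OF that] by (simp add: inner_add_left algebra_simps)
      show "(u + \<eta> *\<^sub>R t) \<bullet> f \<noteq> 0" using True tk eta by (simp add: inner_add_left)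
    qed
  qed
qed

section \<open>Cells with five walls in dimension three\<close>

lemma uniform_subset: "uniform W \<Longrightarrow> V \<subseteq> W \<Longrightarrow> uniform V"
  by (auto simp: uniform_def intro: finite_subset)

text \<open>
  Following the direction \<open>y\<close> inside the plane of \<open>f\<close>, the cell is left through a single wall \<open>k\<close>: two
  walls and \<open>f\<close> meet only in the origin.
\<close>
lemma leave_cell:
  fixes W :: "'b::euclidean_space set"
  assumes W: "uniform (insert f W)" and f: "f \<notin> W" and d: "DIM('b) = 3"
    and z: "z \<bullet> f = 0" "\<And>v. v \<in> W \<Longrightarrow> 0 < (z \<bullet> v) * (\<phi> \<bullet> v)"
    and y: "y \<bullet> f = 0" "v1 \<in> W" "(y \<bullet> v1) * (\<phi> \<bullet> v1) < 0" "v2 \<in> W" "0 < (y \<bullet> v2) * (\<phi> \<bullet> v2)"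
  shows "\<exists>k\<in>W. (y \<bullet> k) * (\<phi> \<bullet> k) < 0 \<and>
    (\<exists>p. p \<bullet> f = 0 \<and> p \<bullet> k = 0 \<and> (\<forall>v\<in>W-{k}. 0 < (p \<bullet> v) * (\<phi> \<bullet> v)))"
proof -
  have fin: "finite W" using W by (simp add: uniform_def)
  define a where "a v = (z \<bullet> v) * (\<phi> \<bullet> v)" for v
  define b where "b v = (y \<bullet> v) * (\<phi> \<bullet> v)" for v
  define N where "N = {v \<in> W. b v < 0}"
  have N: "finite N" "N \<noteq> {}" using fin y by (auto simp: N_def b_def)
  obtain k where k: "k \<in> N" "\<And>v. v \<in> N \<Longrightarrow> a k / - b k \<le> a v / - b v"
    using ex_min_if_finite[of "(\<lambda>v. a v / - b v) ` N"] N by (auto simp: not_less)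
  define t where "t = a k / - b k"
  have kW: "k \<in> W" "b k < 0" "0 < a k" using k z by (auto simp: N_def a_def)
  have t: "0 < t" using kW by (simp add: t_def divide_pos_neg)
  define p where "p = z + t *\<^sub>R y"
  have pv: "(p \<bullet> v) * (\<phi> \<bullet> v) = a v + t * b v" for v
    by (simp add: p_def a_def b_def inner_add_left algebra_simps)
  have phik: "\<phi> \<bullet> v \<noteq> 0" if "v \<in> W" for v using z(2)[OF that] by auto
  have "(p \<bullet> k) * (\<phi> \<bullet> k) = 0" unfolding pv using kW by (simp add: t_def)
  then have pk: "p \<bullet> k = 0" using phik[OF kW(1)] by simp
  have pf: "p \<bullet> f = 0" using z y by (simp add: p_def inner_add_left)
  have "0 < (p \<bullet> v2) * (\<phi> \<bullet> v2)"
    unfolding pv using y z(2)[of v2] t by (intro add_pos_pos) (auto simp: a_def b_def)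
  then have p0: "p \<noteq> 0" by auto
  have "0 < (p \<bullet> v) * (\<phi> \<bullet> v)" if v: "v \<in> W - {k}" for v
  proof (cases "b v < 0")
    case True
    then have "t \<le> a v / - b v" using k(2)[of v] v by (simp add: N_def t_def)
    moreover have "0 < - b v" using True by simp
    ultimately have "t * - b v \<le> a v" using pos_le_divide_eq by blast
    then have "0 \<le> a v + t * b v" by simp
    moreover have "p \<bullet> v \<noteq> 0"
    proof
      assume "p \<bullet> v = 0"
      have "f \<noteq> k" "f \<noteq> v" "k \<noteq> v" using f kW v by auto
      then have c: "card {f, k, v} = DIM('b)" using d by simp
      have "independent {f, k, v}"
        using uniformD[OF W, of "{f, k, v}"] kW v c by auto
      then have "p = 0"
        using c pf pk \<open>p \<bullet> v = 0\<close> by (intro orthogonal_to_basis[of "{f, k, v}"]) (auto simp: inner_commute)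
      with p0 show False by simp
    qed
    ultimately show ?thesis using phik[of v] v unfolding pv[symmetric] by (simp add: less_le)
  next
    case False
    then have "0 \<le> t * b v" using t by simp
    moreover have "0 < a v" using z(2) v by (simp add: a_def)
    ultimately show ?thesis unfolding pv by simp
  qed
  then show ?thesis using kW pf pk unfolding b_def by blast
qed

text \<open>
  Induction on the number of planes, starting with the complete cell for five. If the new plane \<open>f\<close> misses the cell,
  all walls survive. Otherwise it cuts the cell in two pieces; every wall belongs to at least one piece, the two walls through
  which the plane of \<open>f\<close> leaves the cell belong to both, and \<open>f\<close> is a new wall of both. Since \<open>5 + 2 = 7\<close>,
  one piece keeps four walls besides \<open>f\<close>.
\<close>
lemma five_walls:
  fixes W :: "'b::euclidean_space set"
  assumes d: "DIM('b) = 3" and n: "5 \<le> card W" and W: "uniform W"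
  shows "\<exists>\<phi>. (\<forall>w\<in>W. \<phi> \<bullet> w \<noteq> 0) \<and> 5 \<le> card {w \<in> W. wall W \<phi> w}"
proof -
  obtain m where "card W = m + 5" using le_Suc_ex[OF n] by (auto simp: add.commute)
  then show ?thesis using W
  proof (induction m arbitrary: W)
    case 0
    then have "card W = 2 * DIM('b) - 1" using d by simp
    then obtain \<phi> where "\<forall>w\<in>W. \<phi> \<bullet> w \<noteq> 0" "\<forall>w\<in>W. wall W \<phi> w"
      using complete_cell[OF 0(2)] d by auto
    moreover from this have "{w \<in> W. wall W \<phi> w} = W" by blast
    ultimately show ?case using 0 by auto
  next
    case (Suc m)
    have finW: "finite W" using Suc.prems by (simp add: uniform_def)
    obtain f where f: "f \<in> W" using Suc.prems by fastforce
    define W0 where "W0 = W - {f}"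
    have Wf: "W = insert f W0" "f \<notin> W0" using f by (auto simp: W0_def)
    have fin: "finite W0" using finW by (simp add: W0_def)
    have cW0: "card W0 = m + 5" using Suc.prems(1) f finW by (simp add: W0_def)
    have u0: "uniform W0" by (rule uniform_subset[OF Suc.prems(2)]) (auto simp: W0_def)
    obtain \<phi> where phi: "\<forall>w\<in>W0. \<phi> \<bullet> w \<noteq> 0" "5 \<le> card {w \<in> W0. wall W0 \<phi> w}"
      using Suc.IH[OF cW0 u0] by blast
    define K where "K = {w \<in> W0. wall W0 \<phi> w}"
    have ind: "independent S" if "S \<subseteq> W" "card S \<le> 3" for S
      using uniformD[OF Suc.prems(2)] that d by simp
    have agree: "0 < x * y" if "0 < x * c" "0 < y * c" for x y c :: real
      using that by (auto simp: zero_less_mult_iff)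
    have sq: "0 < x * x" if "x \<noteq> 0" for x :: real using that by (simp add: zero_less_mult_iff) argo
    have "\<exists>u. u \<bullet> k = 0 \<and> (\<forall>v\<in>W0-{k}. 0 < (u \<bullet> v) * (\<phi> \<bullet> v)) \<and> u \<bullet> f \<noteq> 0" if k: "k \<in> K" for k
    proof -
      have "f \<noteq> k" using k Wf by (auto simp: K_def)
      then have "independent {f, k}" using k f by (intro ind) (auto simp: K_def W0_def)
      moreover have "wall W0 \<phi> k" using k by (simp add: K_def)
      ultimately obtain u where "u \<bullet> k = 0" "\<And>v. v \<in> W0 - {k} \<Longrightarrow> 0 < (u \<bullet> v) * (\<phi> \<bullet> v)" "u \<bullet> f \<noteq> 0"
        using wall_generic[OF fin] \<open>f \<noteq> k\<close> by metis
      then show ?thesis by blast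
    qed
    then obtain u where u: "\<And>k. k \<in> K \<Longrightarrow> u k \<bullet> k = 0"
      "\<And>k v. k \<in> K \<Longrightarrow> v \<in> W0 - {k} \<Longrightarrow> 0 < (u k \<bullet> v) * (\<phi> \<bullet> v)"
      "\<And>k. k \<in> K \<Longrightarrow> u k \<bullet> f \<noteq> 0" by metis
    define piece where "piece e \<psi> \<longleftrightarrow> (\<forall>v\<in>W0. 0 < (\<psi> \<bullet> v) * (\<phi> \<bullet> v)) \<and> 0 < (\<psi> \<bullet> f) * e" for e :: real and \<psi>
    have piece_nz: "\<psi> \<bullet> w \<noteq> 0" if "piece e \<psi>" "w \<in> W" for e \<psi> w
      using that unfolding piece_def Wf(1) by fastforce
    have piece_wall: "wall W \<psi> k"
      if "piece e \<psi>" "v \<bullet> k = 0" "\<And>w. w \<in> W0 - {k} \<Longrightarrow> 0 < (v \<bullet> w) * (\<phi> \<bullet> w)" "0 < (v \<bullet> f) * e" for e \<psi> v k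
      unfolding wall_def Wf(1)
    proof (intro exI[of _ v] conjI ballI that(2))
      fix w assume w: "w \<in> insert f W0 - {k}"
      show "0 < (v \<bullet> w) * (\<psi> \<bullet> w)"
        using that w agree[of "v \<bullet> w" "\<phi> \<bullet> w" "\<psi> \<bullet> w"] agree[of "v \<bullet> f" e "\<psi> \<bullet> f"]
        unfolding piece_def by (cases "w = f") auto
    qed
    have piece_ex: "\<exists>\<psi>. piece e \<psi>" if k: "k \<in> K" "0 < (u k \<bullet> f) * e" for k e
    proof -
      have "\<forall>\<^sub>F \<eta> in at_right 0. 0 < (u k \<bullet> f) * e + \<eta> * ((\<phi> \<bullet> f) * e)"
        by (rule eventually_pos_perturb[OF k(2)])
      then have "\<forall>\<^sub>F \<eta> in at_right 0. 0 < \<eta> \<and> 0 < (u k \<bullet> f) * e + \<eta> * ((\<phi> \<bullet> f) * e)"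
        using eventually_at_right_less[of "0::real"] by eventually_elim simp
      then obtain \<eta> where eta: "0 < \<eta>" "0 < (u k \<bullet> f) * e + \<eta> * ((\<phi> \<bullet> f) * e)"
        using eventually_happens'[OF trivial_limit_at_right_real] by blast
      have "piece e (u k + \<eta> *\<^sub>R \<phi>)"
        unfolding piece_def
      proof (intro conjI ballI)
        fix v assume v: "v \<in> W0"
        have pos: "0 < \<eta> * ((\<phi> \<bullet> v) * (\<phi> \<bullet> v))" using eta sq phi v by simp
        have nn: "0 \<le> (u k \<bullet> v) * (\<phi> \<bullet> v)"
          using u(1)[OF k(1)] u(2)[OF k(1), of v] v by (cases "v = k") (auto intro: less_imp_le)
        have "0 < (u k \<bullet> v) * (\<phi> \<bullet> v) + \<eta> * ((\<phi> \<bullet> v) * (\<phi> \<bullet> v))" by (rule add_nonneg_pos[OF nn pos])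
        then show "0 < ((u k + \<eta> *\<^sub>R \<phi>) \<bullet> v) * (\<phi> \<bullet> v)" by (simp add: inner_add_left algebra_simps)
      qed (use eta in \<open>simp add: inner_add_left algebra_simps\<close>)
      then show ?thesis by blast
    qed
    define Ke where "Ke e = {k \<in> K. 0 < (u k \<bullet> f) * e}" for e :: real
    have K_union: "K = Ke 1 \<union> Ke (- 1)" using u(3) by (fastforce simp: Ke_def)
    have Ke_wall: "Ke e \<subseteq> {w \<in> W. wall W \<psi> w}" if "piece e \<psi>" for e \<psi>
    proof
      fix k assume k: "k \<in> Ke e"
      then have kK: "k \<in> K" "0 < (u k \<bullet> f) * e" by (auto simp: Ke_def)
      have "wall W \<psi> k" by (rule piece_wall[OF that u(1)[OF kK(1)] u(2)[OF kK(1)] kK(2)])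
      then show "k \<in> {w \<in> W. wall W \<psi> w}" using kK(1) by (simp add: K_def W0_def)
    qed
    have finwalls: "finite {w \<in> W. wall W \<psi> w}" for \<psi> using finW by simp
    show ?case
    proof (cases "\<exists>e\<in>{1, - 1}. Ke e = {}")
      case True
      then obtain e where e: "e \<in> {1, - 1}" "Ke e = K" using K_union by auto
      then have "Ke e \<noteq> {}" using phi(2)[folded K_def] by force
      then obtain \<psi> where psi: "piece e \<psi>" using piece_ex by (auto simp: Ke_def)
      have "5 \<le> card {w \<in> W. wall W \<psi> w}"
        using card_mono[OF finwalls Ke_wall[OF psi]] phi(2) e(2) by (simp add: K_def)
      then show ?thesis using piece_nz[OF psi] by blast
    next
      case False
      then obtain k k' where "k \<in> Ke 1" "k' \<in> Ke (- 1)" by auto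
      then obtain \<psi>1 \<psi>2 where psi: "piece 1 \<psi>1" "piece (- 1) \<psi>2"
        using piece_ex unfolding Ke_def by blast
      define z where "z = (- (\<psi>2 \<bullet> f)) *\<^sub>R \<psi>1 + (\<psi>1 \<bullet> f) *\<^sub>R \<psi>2"
      have zf: "z \<bullet> f = 0" by (simp add: z_def inner_add_left inner_diff_left)
      have zv: "0 < (z \<bullet> v) * (\<phi> \<bullet> v)" if "v \<in> W0" for v
      proof -
        have A: "0 < - (\<psi>2 \<bullet> f)" "0 < \<psi>1 \<bullet> f" "0 < (\<psi>1 \<bullet> v) * (\<phi> \<bullet> v)" "0 < (\<psi>2 \<bullet> v) * (\<phi> \<bullet> v)"
          using psi that unfolding piece_def by auto
        have "0 < (- (\<psi>2 \<bullet> f)) * ((\<psi>1 \<bullet> v) * (\<phi> \<bullet> v)) + (\<psi>1 \<bullet> f) * ((\<psi>2 \<bullet> v) * (\<phi> \<bullet> v))"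
          by (rule add_pos_pos[OF mult_pos_pos[OF A(1,3)] mult_pos_pos[OF A(2,4)]])
        then show ?thesis by (simp add: z_def inner_add_left inner_diff_left algebra_simps)
      qed
      have "2 \<le> card W0" using cW0 by simp
      then obtain S where "S \<subseteq> W0" "card S = 2" by (rule obtain_subset_with_card_n)
      then obtain v1 v2 where v12: "v1 \<noteq> v2" "v1 \<in> W0" "v2 \<in> W0" by (auto simp: card_2_iff)
      have "card {f, v1, v2} \<le> 3" by (simp add: card_insert_if)
      then have "independent {f, v1, v2}" using v12 Wf by (intro ind) auto
      then obtain y where "\<forall>b\<in>{f, v1, v2}. b \<bullet> y = (if b = f then 0 else if b = v1 then - (\<phi> \<bullet> v1) else \<phi> \<bullet> v2)"
        using prescribed_inner[of _ "\<lambda>b. if b = f then 0 else if b = v1 then - (\<phi> \<bullet> v1) else \<phi> \<bullet> v2"] by blast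
      then have y: "y \<bullet> f = 0" "y \<bullet> v1 = - (\<phi> \<bullet> v1)" "y \<bullet> v2 = \<phi> \<bullet> v2"
        using v12 Wf(2) by (auto simp: inner_commute)
      have b: "(y \<bullet> v1) * (\<phi> \<bullet> v1) < 0" "0 < (y \<bullet> v2) * (\<phi> \<bullet> v2)"
        using y sq phi v12 by auto
      have uW: "uniform (insert f W0)" using Suc.prems(2) Wf by simp
      obtain k1 where k1: "k1 \<in> W0" "(y \<bullet> k1) * (\<phi> \<bullet> k1) < 0"
          "\<exists>p. p \<bullet> f = 0 \<and> p \<bullet> k1 = 0 \<and> (\<forall>v\<in>W0-{k1}. 0 < (p \<bullet> v) * (\<phi> \<bullet> v))"
        using leave_cell[OF uW Wf(2) d zf zv y(1) v12(2) b(1) v12(3) b(2)] by blast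
      obtain k2 where k2: "k2 \<in> W0" "((- y) \<bullet> k2) * (\<phi> \<bullet> k2) < 0"
          "\<exists>p. p \<bullet> f = 0 \<and> p \<bullet> k2 = 0 \<and> (\<forall>v\<in>W0-{k2}. 0 < (p \<bullet> v) * (\<phi> \<bullet> v))"
        using leave_cell[OF uW Wf(2) d zf zv _ v12(3) _ v12(2), of "- y"] y(1) b by auto
      have k12: "k1 \<noteq> k2" using k1 k2 by auto
      have both: "wall W \<psi> k"
        if k: "k \<in> W0" "\<exists>p. p \<bullet> f = 0 \<and> p \<bullet> k = 0 \<and> (\<forall>v\<in>W0-{k}. 0 < (p \<bullet> v) * (\<phi> \<bullet> v))"
          and psi: "piece e \<psi>" and e: "e \<noteq> 0" for k e \<psi>
      proof -
        obtain p where p: "p \<bullet> f = 0" "p \<bullet> k = 0" "\<And>v. v \<in> W0 - {k} \<Longrightarrow> 0 < (p \<bullet> v) * (\<phi> \<bullet> v)"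
          using k(2) by blast
        have fk: "f \<noteq> k" using k Wf by auto
        then have "independent {f, k}" using k f by (intro ind) (auto simp: W0_def)
        then obtain t where "\<forall>b\<in>{f, k}. b \<bullet> t = (if b = f then e else 0)"
          using prescribed_inner[of _ "\<lambda>b. if b = f then e else 0"] by blast
        then have t: "t \<bullet> f = e" "t \<bullet> k = 0" using fk by (auto simp: inner_commute)
        have "\<forall>\<^sub>F \<eta> in at_right 0. \<forall>v\<in>W0-{k}. 0 < (p \<bullet> v) * (\<phi> \<bullet> v) + \<eta> * ((t \<bullet> v) * (\<phi> \<bullet> v))"
          using fin p by (intro eventually_ball_finite ballI eventually_pos_perturb) simp_all
        then have "\<forall>\<^sub>F \<eta> in at_right 0. 0 < \<eta> \<and> (\<forall>v\<in>W0-{k}. 0 < (p \<bullet> v) * (\<phi> \<bullet> v) + \<eta> * ((t \<bullet> v) * (\<phi> \<bullet> v)))"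
          using eventually_at_right_less[of "0::real"] by eventually_elim simp
        then obtain \<eta> where eta: "0 < \<eta>"
            "\<And>v. v \<in> W0 - {k} \<Longrightarrow> 0 < (p \<bullet> v) * (\<phi> \<bullet> v) + \<eta> * ((t \<bullet> v) * (\<phi> \<bullet> v))"
          using eventually_happens'[OF trivial_limit_at_right_real] by blast
        show ?thesis
        proof (rule piece_wall[OF psi, of "p + \<eta> *\<^sub>R t"])
          show "(p + \<eta> *\<^sub>R t) \<bullet> k = 0" using p t by (simp add: inner_add_left)
          show "0 < ((p + \<eta> *\<^sub>R t) \<bullet> f) * e" using p t eta sq[OF e] by (simp add: inner_add_left mult.assoc)
          show "0 < ((p + \<eta> *\<^sub>R t) \<bullet> v) * (\<phi> \<bullet> v)" if "v \<in> W0 - {k}" for v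
            using eta(2)[OF that] by (simp add: inner_add_left algebra_simps)
        qed
      qed
      have f_wall: "wall W \<psi> f" if "piece e \<psi>" for e \<psi>
        unfolding wall_def
      proof (intro exI[of _ z] conjI ballI zf)
        fix v assume "v \<in> W - {f}"
        then have "v \<in> W0" by (simp add: W0_def)
        then show "0 < (z \<bullet> v) * (\<psi> \<bullet> v)" using zv that agree unfolding piece_def by blast
      qed
      define L where "L \<psi> = {k \<in> W0. wall W \<psi> k}" for \<psi>
      have finL: "finite (L \<psi>)" for \<psi> using fin by (simp add: L_def)
      have "K \<subseteq> L \<psi>1 \<union> L \<psi>2"
        using Ke_wall[OF psi(1)] Ke_wall[OF psi(2)] K_union by (auto simp: L_def K_def)
      then have "5 \<le> card (L \<psi>1 \<union> L \<psi>2)"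
        using card_mono[OF finite_UnI[OF finL finL]] phi(2) unfolding K_def by (meson le_trans)
      moreover have "{k1, k2} \<subseteq> L \<psi>1 \<inter> L \<psi>2"
        using both[OF k1(1,3) psi(1)] both[OF k1(1,3) psi(2)] both[OF k2(1,3) psi(1)] both[OF k2(1,3) psi(2)] k1(1) k2(1)
        by (simp add: L_def)
      then have "2 \<le> card (L \<psi>1 \<inter> L \<psi>2)"
        using card_mono[OF finite_Int, of "L \<psi>1" "L \<psi>2" "{k1, k2}"] finL k12 by simp
      moreover have "card (L \<psi>1) + card (L \<psi>2) = card (L \<psi>1 \<union> L \<psi>2) + card (L \<psi>1 \<inter> L \<psi>2)"
        by (rule card_Un_Int[OF finL finL])
      ultimately have "4 \<le> card (L \<psi>1) \<or> 4 \<le> card (L \<psi>2)" by linarith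
      then obtain e \<psi> where e: "piece e \<psi>" "4 \<le> card (L \<psi>)" using psi by blast
      have "insert f (L \<psi>) \<subseteq> {w \<in> W. wall W \<psi> w}" using f_wall[OF e(1)] f by (auto simp: L_def W0_def)
      moreover have "card (insert f (L \<psi>)) = Suc (card (L \<psi>))"
        using finL Wf(2) by (simp add: L_def)
      ultimately have "5 \<le> card {w \<in> W. wall W \<psi> w}"
        using card_mono[OF finwalls, of "insert f (L \<psi>)" \<psi>] e(2) by simp
      then show ?thesis using piece_nz[OF e(1)] by blast
    qed
  qed
qed

section \<open>From walls to vertices\<close>

lemma uniform_lift:
  fixes X :: "'a::euclidean_space set"
  assumes "finite X" "general_position X"
  shows "uniform ((\<lambda>x. (x, 1::real)) ` X)"
  unfolding uniform_def
proof (intro conjI allI impI)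
  fix S assume S: "S \<subseteq> (\<lambda>x. (x, 1::real)) ` X" "card S \<le> DIM('a \<times> real)"
  then obtain C where C: "C \<subseteq> X" "S = (\<lambda>x. (x, 1::real)) ` C" by (meson subset_imageE)
  have inj: "inj_on (\<lambda>x. (x, 1::real)) C" by (auto intro: inj_onI)
  have fin: "finite C" using C(1) assms(1) by (rule finite_subset)
  have "card C \<le> DIM('a) + 1" using S(2) C inj by (simp add: card_image)
  then have ind: "\<not> affine_dependent C" using assms(2) C fin unfolding general_position_def by blast
  show "independent S"
  proof
    assume "dependent S"
    then obtain u where u: "\<exists>v\<in>S. u v \<noteq> 0" "(\<Sum>v\<in>S. u v *\<^sub>R v) = 0"
      using dependent_finite[of S] fin C by auto
    have "(\<Sum>x\<in>C. (u (x, 1) *\<^sub>R x, u (x, 1))) = (0, 0)"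
      using u(2) inj by (simp add: C sum.reindex zero_prod_def)
    then have "(\<Sum>x\<in>C. u (x, 1) *\<^sub>R x) = 0" "(\<Sum>x\<in>C. u (x, 1)) = 0"
      by (simp_all add: sum_prod)
    moreover have "\<exists>x\<in>C. u (x, 1) \<noteq> 0" using u(1) C by auto
    ultimately have "affine_dependent C"
      using affine_dependent_explicit_finite[OF fin] by (intro iffD2[OF affine_dependent_explicit_finite[OF fin]] exI[of _ "\<lambda>x. u (x, 1)"]) simp
    with ind show False by simp
  qed
qed (use assms in simp)

lemma face_number_le_proj_h:
  assumes "finite X" "(A, b, c, \<delta>) \<in> permissible_parameters X"
  shows "face_number k (convex hull (projective_map A b c \<delta> ` X)) \<le> proj_h k X"
  unfolding proj_h_def using assms
  by (intro Max_ge proj_h_range(1)) (auto intro!: image_eqI[of _ _ "(A, b, c, \<delta>)"])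

text \<open>
  The transformation \<open>x \<mapsto> x / \<phi>(x)\<close> works if the constant term \<open>\<delta>\<close> of \<open>\<phi>\<close> does not vanish, which a small
  perturbation inside the cell achieves. Then \<open>1 / \<phi>(x)\<close> is an affine function of the image of \<open>x\<close>, and so is
  the quotient of the linear form \<open>u\<close> of a wall by \<open>\<phi>\<close>: it separates the image of \<open>x\<close> from the other images.
\<close>
lemma card_walls_le_proj_h:
  fixes X :: "'a::euclidean_space set" and \<phi> :: "'a \<times> real"
  defines "W \<equiv> (\<lambda>x. (x, 1::real)) ` X"
  assumes fin: "finite X" and phi: "\<And>w. w \<in> W \<Longrightarrow> \<phi> \<bullet> w \<noteq> 0"
  shows "card {w \<in> W. wall W \<phi> w} \<le> proj_h 0 X"
proof -
  have finW: "finite W" using fin by (simp add: W_def)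
  obtain \<eta> where eta: "snd \<phi> + \<eta> \<noteq> 0" "\<And>w. w \<in> W \<Longrightarrow> 0 < (\<phi> \<bullet> w) * (\<phi> \<bullet> w) + \<eta> * ((\<phi> \<bullet> w) * snd w)"
  proof -
    have "\<forall>\<^sub>F \<eta> in at_right 0. \<forall>w\<in>W. 0 < (\<phi> \<bullet> w) * (\<phi> \<bullet> w) + \<eta> * ((\<phi> \<bullet> w) * snd w)"
      using finW phi by (intro eventually_ball_finite ballI eventually_pos_perturb) (auto simp: zero_less_mult_iff not_less_iff_gr_or_eq)
    moreover have "\<forall>\<^sub>F \<eta> in at_right 0. \<eta> \<noteq> - snd \<phi>"
    proof (cases "snd \<phi> = 0")
      case True
      then show ?thesis using eventually_at_right_less[of "0::real"] by (auto elim: eventually_mono)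
    next
      case False
      then have "\<forall>\<^sub>F \<eta> in at_right 0. 0 < snd \<phi> * snd \<phi> + \<eta> * snd \<phi>"
        by (intro eventually_pos_perturb) (auto simp: zero_less_mult_iff)
      then show ?thesis by eventually_elim auto
    qed
    ultimately have "\<forall>\<^sub>F \<eta> in at_right 0. snd \<phi> + \<eta> \<noteq> 0 \<and>
        (\<forall>w\<in>W. 0 < (\<phi> \<bullet> w) * (\<phi> \<bullet> w) + \<eta> * ((\<phi> \<bullet> w) * snd w))"
      by eventually_elim (auto simp: add_eq_0_iff)
    then show thesis
      using eventually_happens'[OF trivial_limit_at_right_real] that by blast
  qed
  define c where "c = fst \<phi>"
  define \<delta> where "\<delta> = snd \<phi> + \<eta>"
  have d0: "\<delta> \<noteq> 0" using eta by (simp add: \<delta>_def)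
  have sgn: "0 < (\<phi> \<bullet> (x, 1)) * (c \<bullet> x + \<delta>)" if "x \<in> X" for x
    using eta(2)[of "(x, 1)"] that by (simp add: W_def c_def \<delta>_def inner_prod_def algebra_simps)
  define T where "T = projective_map (\<lambda>x. x) 0 c \<delta>"
  have perm: "((\<lambda>x. x), 0, c, \<delta>) \<in> permissible_parameters X"
    using sgn d0 by (fastforce simp: permissible_parameters_def linear_id[unfolded id_def])
  define K where "K = {x \<in> X. wall W \<phi> (x, 1)}"
  have sep: "T x \<notin> convex hull (T ` (X - {x}))" if x: "x \<in> K" for x
  proof -
    obtain p q where u: "(p, q) \<bullet> (x, 1::real) = 0"
      "\<And>v. v \<in> W - {(x, 1)} \<Longrightarrow> 0 < ((p, q) \<bullet> v) * (\<phi> \<bullet> v)"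
      using x unfolding K_def wall_def by auto
    define g where "g z = p \<bullet> z + q * (1 - c \<bullet> z) / \<delta>" for z
    have gT: "g (T y) = (p \<bullet> y + q) / (c \<bullet> y + \<delta>)" if "y \<in> X" for y
    proof -
      have nz: "c \<bullet> y + \<delta> \<noteq> 0" using sgn[OF that] by auto
      have "(1 - c \<bullet> T y) / \<delta> = 1 / (c \<bullet> y + \<delta>)"
        using nz d0 by (simp add: T_def projective_map_def divide_simps)
      moreover have "p \<bullet> T y = (p \<bullet> y) / (c \<bullet> y + \<delta>)"
        by (simp add: T_def projective_map_def divide_inverse mult.commute)
      moreover have "g (T y) = p \<bullet> T y + q * ((1 - c \<bullet> T y) / \<delta>)" by (simp add: g_def)
      ultimately show ?thesis by (simp add: add_divide_distrib)
    qed
    have xX: "x \<in> X" using x by (simp add: K_def)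
    have "g (T x) = 0" using gT[OF xX] u(1) by (simp add: inner_prod_def)
    moreover have "0 < g (T y)" if y: "y \<in> X - {x}" for y
    proof -
      have "0 < ((p, q) \<bullet> (y, 1)) * (\<phi> \<bullet> (y, 1))" using u(2)[of "(y, 1)"] y by (auto simp: W_def)
      then have "0 < (p \<bullet> y + q) * (\<phi> \<bullet> (y, 1))" by (simp add: inner_prod_def)
      moreover have "0 < (\<phi> \<bullet> (y, 1)) * (c \<bullet> y + \<delta>)" using sgn y by simp
      ultimately have "0 < (p \<bullet> y + q) * (c \<bullet> y + \<delta>)" by (auto simp: zero_less_mult_iff)
      then show ?thesis using gT[of y] y by (auto simp: zero_less_divide_iff zero_less_mult_iff)
    qed
    then have "convex hull (T ` (X - {x})) \<subseteq> {z. 0 < g z}"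
    proof (intro hull_minimal)
      have "{z. 0 < g z} = {z. (p - (q / \<delta>) *\<^sub>R c) \<bullet> z > - (q / \<delta>)}"
        by (auto simp: g_def inner_diff_left right_diff_distrib diff_divide_distrib)
      then show "convex {z. 0 < g z}" by (simp only: convex_halfspace_gt)
    qed auto
    ultimately show ?thesis by auto
  qed
  have ext: "T x extreme_point_of convex hull (T ` X)" if "x \<in> K" for x
  proof -
    have "T ` X = insert (T x) (T ` (X - {x}))" using that by (auto simp: K_def)
    then show ?thesis using extreme_point_of_convex_hull_insert[OF _ sep[OF that]] fin by simp
  qed
  have "inj_on T K"
  proof (rule inj_onI, rule ccontr)
    fix x y assume xy: "x \<in> K" "y \<in> K" "T x = T y" "x \<noteq> y"
    then have "T x \<in> T ` (X - {x})" by (auto simp: K_def)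
    then show False using sep[OF xy(1)] hull_inc by metis
  qed
  then have "card K = card (T ` K)" by (simp add: card_image)
  also have "\<dots> \<le> face_number 0 (convex hull (T ` X))"
    unfolding face_number_0
  proof (rule card_mono)
    show "finite {v. v extreme_point_of convex hull T ` X}"
      by (rule finite_subset[OF extreme_points_of_convex_hull]) (use fin in simp)
  qed (use ext in auto)
  also have "\<dots> \<le> proj_h 0 X"
    unfolding T_def by (rule face_number_le_proj_h[OF fin perm])
  finally have "card K \<le> proj_h 0 X" .
  moreover have "{w \<in> W. wall W \<phi> w} = (\<lambda>x. (x, 1)) ` K" by (auto simp: W_def K_def)
  moreover have "inj_on (\<lambda>x. (x, 1::real)) K" by (auto intro: inj_onI)
  ultimately show ?thesis by (simp add: card_image)
qed

lemma proj_h_ge_card: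
  fixes X :: "'a::euclidean_space set"
  assumes d: "2 \<le> DIM('a)" and X: "finite X" "general_position X" "card X \<le> 2 * DIM('a) + 1"
  shows "card X \<le> proj_h 0 X"
proof -
  let ?l = "\<lambda>x. (x, 1::real)"
  obtain Y where Y: "X \<subseteq> Y" "finite Y" "card Y = 2 * DIM('a) + 1" "general_position Y"
    using general_position_extend_card[OF X] by blast
  have inj: "inj_on ?l A" for A :: "'a set" by (auto intro: inj_onI)
  obtain \<phi> where phi: "\<forall>w\<in>?l ` Y. \<phi> \<bullet> w \<noteq> 0" "\<forall>w\<in>?l ` Y. wall (?l ` Y) \<phi> w"
    using complete_cell[OF uniform_lift[OF Y(2,4)]] d Y(3) by (auto simp: card_image[OF inj])
  have "{w \<in> ?l ` X. wall (?l ` X) \<phi> w} = ?l ` X"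
    using phi(2) Y(1) wall_subset[of "?l ` X" "?l ` Y"] by blast
  then have "card (?l ` X) \<le> proj_h 0 X"
    using card_walls_le_proj_h[OF X(1), of \<phi>] phi(1) Y(1) by auto
  then show ?thesis by (simp add: card_image[OF inj])
qed

lemma proj_h_ge_5:
  fixes X :: "'a::euclidean_space set"
  assumes "DIM('a) = 2" "finite X" "general_position X" "5 \<le> card X"
  shows "5 \<le> proj_h 0 X"
proof -
  let ?l = "\<lambda>x. (x, 1::real)"
  have inj: "inj_on ?l A" for A :: "'a set" by (auto intro: inj_onI)
  obtain \<phi> where "\<forall>w\<in>?l ` X. \<phi> \<bullet> w \<noteq> 0" "5 \<le> card {w \<in> ?l ` X. wall (?l ` X) \<phi> w}"
    using five_walls[OF _ _ uniform_lift[OF assms(2,3)]] assms by (auto simp: card_image[OF inj])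
  moreover from this(1) have "card {w \<in> ?l ` X. wall (?l ` X) \<phi> w} \<le> proj_h 0 X"
    by (intro card_walls_le_proj_h[OF assms(2)]) blast
  ultimately show ?thesis by linarith
qed

lemma proj_h_le_card:
  fixes X :: "'a::euclidean_space set"
  assumes "finite X"
  shows "proj_h 0 X \<le> card X"
  unfolding proj_h_def
proof (rule Max.boundedI[OF proj_h_range(1,2)[OF assms]])
  fix v assume "v \<in> (\<lambda>(A, b, c, \<delta>). face_number 0 (convex hull (projective_map A b c \<delta> ` X))) ` permissible_parameters X"
  then obtain A b c \<delta> where "v = face_number 0 (convex hull (projective_map A b c \<delta> ` X))" by auto
  also have "\<dots> \<le> card (projective_map A b c \<delta> ` X)" using assms by (intro face_number_0_le) auto
  also have "\<dots> \<le> card X" using assms by (rule card_image_le)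
  finally show "v \<le> card X" .
qed

lemma ex_general_position:
  "\<exists>X :: 'a::euclidean_space set. finite X \<and> card X = n \<and> general_position X"
  using general_position_extend_card[of "{} :: 'a set" n] by (auto simp: general_position_def)

lemma proj_H_leI:
  fixes X :: "'a::euclidean_space set"
  assumes "finite X" "card X = n" "general_position X" "proj_h k X \<le> m"
  shows "proj_H k n TYPE('a) \<le> m"
proof -
  have "proj_H k n TYPE('a) \<le> proj_h k X"
    unfolding proj_H_def using finite_proj_H_range assms by (intro Min_le) auto
  with assms(4) show ?thesis by simp
qed

lemma proj_H_geI:
  assumes "\<And>X :: 'a::euclidean_space set. finite X \<Longrightarrow> card X = n \<Longrightarrow> general_position X \<Longrightarrow> m \<le> proj_h k X"
  shows "m \<le> proj_H k n TYPE('a)"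
  unfolding proj_H_def using finite_proj_H_range ex_general_position[where 'a = 'a, of n] assms
  by (intro Min.boundedI) auto

text \<open>
  With \<open>p = \<lfloor>d/2\<rfloor>\<close> the size condition reads \<open>n \<ge> 2d + p + L\<close> for \<open>L \<le> 3\<close>, and each further vertex lost costs \<open>p\<close>
  points. As \<open>\<lceil>(d + 1) / 2\<rceil> = p + 1\<close> and \<open>p \<le> d - 2\<close> for \<open>d \<ge> 4\<close>, this is enough for all upper bounds.
\<close>
lemma few_vertices:
  fixes L n :: nat
  assumes d: "2 \<le> DIM('a::euclidean_space)" and n: "2 \<le> n"
    and "L + 2 * DIM('a) + DIM('a) div 2 + (DIM('a) div 2 - 1) * (L - 3) \<le> n"
  shows "proj_H 0 n TYPE('a) + L \<le> n"
proof -
  obtain X :: "'a set" where X: "finite X" "card X = n" "general_position X" "proj_h 0 X + L \<le> n"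
    using ex_few_vertices[OF d n _ assms(3)] by force
  then have "proj_H 0 n TYPE('a) \<le> n - L" by (intro proj_H_leI[of X]) auto
  with X(4) show ?thesis by linarith
qed

lemma extreme_points_line:
  fixes P :: "'a::euclidean_space set"
  assumes "DIM('a) = 1"
  shows "\<not> 3 \<le> card {v. v extreme_point_of P}"
proof
  assume "3 \<le> card {v. v extreme_point_of P}"
  then obtain S where "S \<subseteq> {v. v extreme_point_of P}" "card S = 3"
    by (rule obtain_subset_with_card_n)
  then obtain x y z where xyz: "x \<noteq> y" "y \<noteq> z" "x \<noteq> z"
    "x extreme_point_of P" "y extreme_point_of P" "z extreme_point_of P"
    by (auto simp: card_3_iff)
  obtain b :: 'a where b: "Basis = {b}" using assms card_1_singletonE by blast
  have rep: "v = (v \<bullet> b) *\<^sub>R b" for v using euclidean_representation[of v] by (simp add: b)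
  have between: "v \<in> open_segment u w" if "u \<bullet> b < v \<bullet> b" "v \<bullet> b < w \<bullet> b" for u v w
  proof -
    define t where "t = (v \<bullet> b - u \<bullet> b) / (w \<bullet> b - u \<bullet> b)"
    have t: "0 < t" "t < 1" using that by (auto simp: t_def divide_simps)
    have "v \<bullet> b = (1 - t) * (u \<bullet> b) + t * (w \<bullet> b)"
    proof -
      have "t * (w \<bullet> b - u \<bullet> b) = v \<bullet> b - u \<bullet> b" using that by (simp add: t_def)
      then show ?thesis by (simp add: algebra_simps)
    qed
    then have "v = (1 - t) *\<^sub>R u + t *\<^sub>R w"
      using rep[of u] rep[of v] rep[of w] by (metis scaleR_add_left scaleR_scaleR)
    moreover have "u \<noteq> w" using that by auto
    ultimately show ?thesis using t by (auto simp: in_segment)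
  qed
  have ne: "u \<bullet> b \<noteq> v \<bullet> b" if "u \<noteq> v" for u v using rep[of u] rep[of v] that by metis
  have no: "\<not> (u \<bullet> b < v \<bullet> b \<and> v \<bullet> b < w \<bullet> b)"
    if "u extreme_point_of P" "v extreme_point_of P" "w extreme_point_of P" for u v w
    using between[of u v w] that unfolding extreme_point_of_def by blast
  show False
    using ne[OF xyz(1)] ne[OF xyz(2)] ne[OF xyz(3)]
      no[OF xyz(4,5,6)] no[OF xyz(4,6,5)] no[OF xyz(5,4,6)] no[OF xyz(5,6,4)] no[OF xyz(6,4,5)] no[OF xyz(6,5,4)]
    by linarith
qed

lemma proj_h_line:
  fixes X :: "'a::euclidean_space set"
  assumes d: "DIM('a) = 1" and X: "finite X" "2 \<le> card X"
  shows "proj_h 0 X = 2"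
proof (rule antisym)
  show "proj_h 0 X \<le> 2"
    unfolding proj_h_def
  proof (rule Max.boundedI[OF proj_h_range(1,2)[OF X(1)]])
    fix v assume "v \<in> (\<lambda>(A, b, c, \<delta>). face_number 0 (convex hull (projective_map A b c \<delta> ` X))) ` permissible_parameters X"
    then have "\<not> 3 \<le> v" using extreme_points_line[OF d] by (auto simp: face_number_0)
    then show "v \<le> 2" by simp
  qed
next
  have "\<not> face_number 0 (convex hull X) \<le> 1"
  proof
    assume "face_number 0 (convex hull X) \<le> 1"
    then have le: "card {v. v extreme_point_of convex hull X} \<le> 1" by (simp add: face_number_0)
    have "finite {v. v extreme_point_of convex hull X}"
      using extreme_points_of_convex_hull X(1) by (rule finite_subset)
    then have "\<forall>v\<in>{v. v extreme_point_of convex hull X}. \<forall>w\<in>{v. v extreme_point_of convex hull X}. v = w"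
      using card_le_Suc0_iff_eq le by fastforce
    then obtain a where "{v. v extreme_point_of convex hull X} \<subseteq> {a}" by blast
    then have "convex hull {v. v extreme_point_of convex hull X} \<subseteq> convex hull {a}" by (rule hull_mono)
    moreover have "convex hull {v. v extreme_point_of convex hull X} = convex hull X"
      using Krein_Milman_Minkowski[of "convex hull X"] X(1) by (simp add: finite_imp_compact_convex_hull)
    moreover have "X \<subseteq> convex hull X" by (rule hull_subset)
    ultimately have "X \<subseteq> {a}" by auto
    then have "card X \<le> 1" using card_mono[of "{a}" X] by simp
    with X(2) show False by simp
  qed
  moreover have "face_number 0 (convex hull X) \<le> proj_h 0 X"
  proof -
    have "projective_map (\<lambda>x. x) 0 0 1 ` X = X" by (simp add: projective_map_def)
    moreover have "((\<lambda>x. x), 0, 0, 1) \<in> permissible_parameters X"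
      by (simp add: permissible_parameters_def linear_id[unfolded id_def])
    ultimately show ?thesis using face_number_le_proj_h[OF X(1)] by metis
  qed
  ultimately show "2 \<le> proj_h 0 X" by simp
qed

theorem theorem1:
  fixes d l n :: nat
  assumes "CARD('d::finite) = d"
    and "d \<ge> 1" and "l \<ge> 1" and "n \<ge> 2"
  shows "(d = 1 \<and> n \<ge> 2 \<longrightarrow> proj_H 0 n TYPE(real ^ 'd) = 2)
    \<and> (d = 2 \<and> n \<ge> 5 \<longrightarrow> proj_H 0 n TYPE(real ^ 'd) = 5)
    \<and> (d = 3 \<and> n \<ge> 7 \<longrightarrow> proj_H 0 n TYPE(real ^ 'd) \<le> 7)
    \<and> (d \<ge> 2 \<and> n \<le> 2 * d + 1 \<longrightarrow> proj_H 0 n TYPE(real ^ 'd) = n)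
    \<and> (d \<ge> 4 \<and> int n \<ge> 2 * int d + \<lceil>(real d + 1) / 2\<rceil>
         \<longrightarrow> int (proj_H 0 n TYPE(real ^ 'd)) \<le> int n - 1)
    \<and> (d \<ge> 4 \<and> int n \<ge> 2 * int d + \<lceil>(real d + 1) / 2\<rceil> + 1
         \<longrightarrow> int (proj_H 0 n TYPE(real ^ 'd)) \<le> int n - 2)
    \<and> (d \<ge> 4 \<and> 2 * int d + 3 + int l * (int d - 2) \<le> int n
              \<and> int n < 2 * int d + 3 + (int l + 1) * (int d - 2)
         \<longrightarrow> int (proj_H 0 n TYPE(real ^ 'd)) \<le> int n - (int l + 2))"
proof -
  have D: "DIM(real ^ 'd) = d" using assms(1) by simp
  let ?H = "proj_H 0 n TYPE(real ^ 'd)"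
  have few: "?H + L \<le> n" if "2 \<le> d" "L + 2 * d + d div 2 + (d div 2 - 1) * (L - 3) \<le> n" for L
    using few_vertices[where 'a = "real ^ 'd", of n L] that assms(4) D by simp
  have trivial: "?H \<le> n"
  proof -
    obtain X :: "(real ^ 'd) set" where X: "finite X" "card X = n" "general_position X"
      using ex_general_position by blast
    then show ?thesis using proj_h_le_card[OF X(1)] by (intro proj_H_leI[of X]) auto
  qed
  have ceil: "\<lceil>(real d + 1) / 2\<rceil> = int (d div 2) + 1"
  proof -
    have "d = 2 * (d div 2) \<or> d = 2 * (d div 2) + 1" by presburger
    then have "real d = 2 * real (d div 2) \<or> real d = 2 * real (d div 2) + 1" by linarith
    then show ?thesis by (intro ceiling_unique) auto
  qed
  show ?thesis
  proof (intro conjI impI)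
    assume "d = 1 \<and> n \<ge> 2"
    then have h: "proj_h 0 X = 2" if "finite X" "card X = n" for X :: "(real ^ 'd) set"
      using proj_h_line[of X] that D by simp
    obtain X :: "(real ^ 'd) set" where X: "finite X" "card X = n" "general_position X"
      using ex_general_position by blast
    show "?H = 2"
      using proj_H_leI[OF X, of 0 2] h[OF X(1,2)] proj_H_geI[where 'a = "real ^ 'd", of n 2 0] h by force
  next
    assume d: "d = 2 \<and> n \<ge> 5"
    have "5 \<le> ?H" using proj_h_ge_5[where 'a = "real ^ 'd"] d D by (intro proj_H_geI) auto
    moreover have "?H \<le> 5"
    proof (cases "n = 5")
      case True
      then show ?thesis using trivial by simp
    next
      case False
      then show ?thesis using few[of "n - 5"] d by simp
    qed
    ultimately show "?H = 5" by simp
  next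
    assume d: "d = 3 \<and> n \<ge> 7"
    then show "?H \<le> 7" using few[of "n - 7"] by simp
  next
    assume d: "d \<ge> 2 \<and> n \<le> 2 * d + 1"
    have "n \<le> ?H"
    proof (rule proj_H_geI)
      fix X :: "(real ^ 'd) set"
      assume "finite X" "card X = n" "general_position X"
      then show "n \<le> proj_h 0 X" using proj_h_ge_card[of X] d D by simp
    qed
    with trivial show "?H = n" by simp
  next
    assume "d \<ge> 4 \<and> int n \<ge> 2 * int d + \<lceil>(real d + 1) / 2\<rceil>"
    then have "?H + 1 \<le> n" using ceil by (intro few) auto
    then show "int ?H \<le> int n - 1" by simp
  next
    assume "d \<ge> 4 \<and> int n \<ge> 2 * int d + \<lceil>(real d + 1) / 2\<rceil> + 1"
    then have "?H + 2 \<le> n" using ceil by (intro few) auto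
    then show "int ?H \<le> int n - 2" by simp
  next
    assume a: "d \<ge> 4 \<and> 2 * int d + 3 + int l * (int d - 2) \<le> int n \<and>
      int n < 2 * int d + 3 + (int l + 1) * (int d - 2)"
    obtain k where l: "l = Suc k" using assms(3) by (cases l) auto
    define p where "p = d div 2"
    have p: "1 \<le> p" "p + 2 \<le> d" using a by (auto simp: p_def)
    have "int l * int p \<le> int l * (int d - 2)" using p by (intro mult_left_mono) auto
    then have "2 * int d + 3 + int l * int p \<le> int n" using a by linarith
    then have "2 * d + 3 + l * p \<le> n" by (simp flip: of_nat_mult of_nat_add)
    moreover have "l * p = p + (p - 1) * k + k"
    proof -
      obtain m where "p = Suc m" using p(1) by (cases p) auto
      then show ?thesis by (simp add: l algebra_simps)
    qed
    ultimately have "?H + (l + 2) \<le> n" using p l a by (intro few) (auto simp: p_def)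
    then show "int ?H \<le> int n - (int l + 2)" by simp
  qed
qed

end
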